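(* Let $T$ be a zero-mean Gaussian isotropic random field on $S^2$ whose angular power spectrum $\{C_\ell\}_{\ell\ge 0}$ satisfies $0<C_\ell<\infty$ for all $\ell\ge 0$ and $C_\ell\le K\ell^{-\alpha}$ for all $\ell\ge 1$, for some $K>0$, $\alpha>2$. Let $\delta,\varepsilon>0$, let $\lambda(\delta,\varepsilon)>0$ be such that the solution $$\{a^{reg}_{\ell m}(\delta,\varepsilon)\}:=\arg\min_{\{\alpha_{\ell m}\}}\left\{\lambda(\delta,\varepsilon)\sum_{\ell m}|\alpha_{\ell m}|+\tfrac12\Big\|T-\sum_{\ell m}\alpha_{\ell m}Y_{\ell m}\Big\|^2_{L^2(S^2)}\right\}$$ (minimum over complex arrays) satisfies $\Pr\{\|T-\sum_{\ell m}a^{reg}_{\ell m}(\delta,\varepsilon)Y_{\ell m}\|_{L^2(S^2)}\le\varepsilon\}\ge1-\delta$, and put $$T^{reg}_{\delta,\varepsilon}(x):=\sum_{\ell m}a^{reg}_{\ell m}(\delta,\varepsilon)Y_{\ell m}(x).$$ Then the random field $T^{reg}_{\delta,\varepsilon}$ is anisotropic and non-Gaussian, for any (arbitrarily small but positive) values of $\delta,\varepsilon$.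
   Context: $\{Y_{\ell m}\}_{\ell\ge0,\,-\ell\le m\le\ell}$ denotes the standard complex orthonormal basis of spherical harmonics of $L^2(S^2)$, with $Y_{\ell m}=(-1)^m\overline{Y}_{\ell,-m}$; $|\cdot|$ is the complex modulus. A random field $T$ on $S^2$ is isotropic if $T(\cdot)$ and $T(g\,\cdot)$ have the same law for all $g\in SO(3)$, and anisotropic otherwise. A zero-mean Gaussian isotropic field has the expansion $T=\sum_{\ell=0}^\infty\sum_{m=-\ell}^{\ell}a_{\ell m}Y_{\ell m}$, where $a_{\ell,-m}=(-1)^m\overline{a}_{\ell m}$, the coefficients $\{a_{\ell m}\}_{\ell\ge0,\,0\le m\le \ell}$ are independent, $a_{\ell0}$ is real centred Gaussian with variance $C_\ell$, and for $m\ne0$ the real and imaginary parts of $a_{\ell m}$ are independent centred Gaussians with variance $C_\ell/2$. The sequence $\{C_\ell\}$ is the angular power spectrum. The minimization is performed for each realization of $T$. *)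

theory Defs
  imports
    "HOL-Probability.Probability"
    "HOL-Computational_Algebra.Polynomial"
begin

abbreviation S2 :: "(real^3) set" where
  "S2 \<equiv> sphere 0 1"

text \<open>Surface measure of the unit sphere, of total mass \<open>4 * pi\<close>, as a cone measure:
  the area of \<open>A\<close> is three times the volume of \<open>{t *\<^sub>R x |t x. 0 < t \<and> t < 1 \<and> x \<in> A}\<close>.\<close>

definition sphere_measure :: "(real^3) measure" where
  "sphere_measure =
     scale_measure 3
       (distr (restrict_space lborel (ball 0 1 - {0})) (restrict_space borel S2)
         (\<lambda>x. x /\<^sub>R norm x))"

text \<open>Rodrigues' formula.\<close>

definition legendre :: "nat \<Rightarrow> real poly" where
  "legendre l = smult (1 / (2 ^ l * fact l)) ((pderiv ^^ l) ([:-1, 0, 1:] ^ l))"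

text \<open>For order \<open>m = k \<ge> 0\<close>, written in Cartesian coordinates: on the sphere
  \<open>sin \<theta> * exp (\<i> * \<phi>) = x$1 + \<i> * x$2\<close> and \<open>cos \<theta> = x$3\<close>, so the associated Legendre
  factor (with the Condon-Shortley phase) times \<open>exp (\<i> * k * \<phi>)\<close> becomes
  \<open>(-1) ^ k * (x$1 + \<i> * x$2) ^ k * P\<^sub>l\<^sup>(\<^sup>k\<^sup>) (x$3)\<close>.\<close>

definition sph_harm_nonneg :: "nat \<Rightarrow> nat \<Rightarrow> real^3 \<Rightarrow> complex" where
  "sph_harm_nonneg l k x =
     of_real (sqrt ((2 * real l + 1) / (4 * pi) * (fact (l - k) / fact (l + k)))
              * (-1) ^ k * poly ((pderiv ^^ k) (legendre l)) (x $ 3))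
     * Complex (x $ 1) (x $ 2) ^ k"

definition sph_harm :: "nat \<Rightarrow> int \<Rightarrow> real^3 \<Rightarrow> complex" where
  "sph_harm l m x =
     (if 0 \<le> m then sph_harm_nonneg l (nat m) x
      else (-1) ^ nat (- m) * cnj (sph_harm_nonneg l (nat (- m)) x))"

definition L2_norm_S2 :: "(real^3 \<Rightarrow> complex) \<Rightarrow> ennreal" where
  "L2_norm_S2 f =
     (let I = (\<integral>\<^sup>+ x. ennreal ((cmod (f x))\<^sup>2) \<partial>sphere_measure)
      in if I = \<infinity> then \<infinity> else ennreal (sqrt (enn2real I)))"

text \<open>Arrays indexed by \<open>(l, m)\<close> with \<open>\<bar>m\<bar> \<le> l\<close>, extended by zero.\<close>

definition harmonic_array :: "(nat \<Rightarrow> int \<Rightarrow> complex) \<Rightarrow> bool" where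
  "harmonic_array \<alpha> \<longleftrightarrow> (\<forall>l m. int l < \<bar>m\<bar> \<longrightarrow> \<alpha> l m = 0)"

definition L2_sums :: "(nat \<Rightarrow> int \<Rightarrow> complex) \<Rightarrow> (real^3 \<Rightarrow> complex) \<Rightarrow> bool" where
  "L2_sums \<alpha> f \<longleftrightarrow>
     f \<in> borel_measurable sphere_measure \<and>
     (\<lambda>L. L2_norm_S2 (\<lambda>x. f x - (\<Sum>l\<le>L. \<Sum>m\<in>{- int l..int l}. \<alpha> l m * sph_harm l m x)))
       \<longlonglongrightarrow> 0"

text \<open>A representative of the sum of the harmonic series in the sense of \<open>L\<^sup>2\<close>;
  meaningful for square-summable, in particular for absolutely summable, arrays.\<close>

definition L2_sum :: "(nat \<Rightarrow> int \<Rightarrow> complex) \<Rightarrow> real^3 \<Rightarrow> complex" where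
  "L2_sum \<alpha> = (SOME f. L2_sums \<alpha> f)"

definition array_l1_norm :: "(nat \<Rightarrow> int \<Rightarrow> complex) \<Rightarrow> ennreal" where
  "array_l1_norm \<alpha> = (\<Sum>l. \<Sum>m\<in>{- int l..int l}. ennreal (cmod (\<alpha> l m)))"

text \<open>Takes the value \<open>\<infinity>\<close> on every array that is not absolutely summable (for
  \<open>lam > 0\<close>), whatever the value of \<^const>\<open>L2_sum\<close> there.\<close>

definition l1_objective ::
  "real \<Rightarrow> (real^3 \<Rightarrow> complex) \<Rightarrow> (nat \<Rightarrow> int \<Rightarrow> complex) \<Rightarrow> ennreal" where
  "l1_objective lam f \<alpha> =
     ennreal lam * array_l1_norm \<alpha> + (L2_norm_S2 (\<lambda>x. f x - L2_sum \<alpha> x))\<^sup>2 / 2"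

definition reg_coeff :: "real \<Rightarrow> (real^3 \<Rightarrow> complex) \<Rightarrow> nat \<Rightarrow> int \<Rightarrow> complex" where
  "reg_coeff lam f = arg_min (l1_objective lam f) harmonic_array"

definition reg_field ::
  "real \<Rightarrow> ('w \<Rightarrow> real^3 \<Rightarrow> real) \<Rightarrow> 'w \<Rightarrow> real^3 \<Rightarrow> complex" where
  "reg_field lam T \<omega> x =
     (\<Sum>l. \<Sum>m\<in>{- int l..int l}.
        reg_coeff lam (\<lambda>y. complex_of_real (T \<omega> y)) l m * sph_harm l m x)"

text \<open>Fields are functions on the ambient space, of which only the restriction to the
  sphere matters.\<close>

definition random_field ::
  "'w measure \<Rightarrow> ('w \<Rightarrow> real^3 \<Rightarrow> 'b::topological_space) \<Rightarrow> bool" where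
  "random_field M X \<longleftrightarrow> (\<lambda>(\<omega>, x). X \<omega> x) \<in> borel_measurable (M \<Otimes>\<^sub>M sphere_measure)"

definition isotropic ::
  "'w measure \<Rightarrow> ('w \<Rightarrow> real^3 \<Rightarrow> 'b::topological_space) \<Rightarrow> bool" where
  "isotropic M X \<longleftrightarrow>
     (\<forall>g::real^3^3. rotation_matrix g \<longrightarrow>
        distr M (\<Pi>\<^sub>M x\<in>S2. borel) (\<lambda>\<omega>. \<lambda>x\<in>S2. X \<omega> (g *v x)) =
        distr M (\<Pi>\<^sub>M x\<in>S2. borel) (\<lambda>\<omega>. \<lambda>x\<in>S2. X \<omega> x))"

text \<open>Constants count as (degenerate) Gaussian variables.\<close>

definition gaussian_rv :: "'w measure \<Rightarrow> ('w \<Rightarrow> real) \<Rightarrow> bool" where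
  "gaussian_rv M Z \<longleftrightarrow>
     Z \<in> borel_measurable M \<and>
     ((\<exists>\<mu>. AE \<omega> in M. Z \<omega> = \<mu>) \<or>
      (\<exists>\<mu> \<sigma>. 0 < \<sigma> \<and> distributed M lborel Z (normal_density \<mu> \<sigma>)))"

text \<open>For complex-valued fields the inner product is \<open>Re (cnj c * z)\<close>, so the condition
  says that the real and imaginary parts are jointly Gaussian.\<close>

definition gaussian_field ::
  "'w measure \<Rightarrow> ('w \<Rightarrow> real^3 \<Rightarrow> 'b::real_inner) \<Rightarrow> bool" where
  "gaussian_field M X \<longleftrightarrow>
     (\<forall>F c. finite F \<and> F \<subseteq> S2 \<longrightarrow> gaussian_rv M (\<lambda>\<omega>. \<Sum>x\<in>F. c x \<bullet> X \<omega> x))"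

definition zero_mean :: "'w measure \<Rightarrow> ('w \<Rightarrow> real^3 \<Rightarrow> real) \<Rightarrow> bool" where
  "zero_mean M X \<longleftrightarrow>
     (\<forall>x\<in>S2. integrable M (\<lambda>\<omega>. X \<omega> x) \<and> (\<integral>\<omega>. X \<omega> x \<partial>M) = 0)"

definition harm_coeff :: "('w \<Rightarrow> real^3 \<Rightarrow> real) \<Rightarrow> nat \<Rightarrow> int \<Rightarrow> 'w \<Rightarrow> complex" where
  "harm_coeff T l m \<omega> =
     (\<integral>x. complex_of_real (T \<omega> x) * cnj (sph_harm l m x) \<partial>sphere_measure)"

text \<open>The spectral representation of a zero-mean Gaussian isotropic field, which is what
  defines its angular power spectrum \<open>C\<close>.  The relation between the coefficients of
  orders \<open>m\<close> and \<open>-m\<close> holds automatically, the field being real.\<close>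

definition angular_power_spectrum ::
  "'w measure \<Rightarrow> ('w \<Rightarrow> real^3 \<Rightarrow> real) \<Rightarrow> (nat \<Rightarrow> real) \<Rightarrow> bool" where
  "angular_power_spectrum M T C \<longleftrightarrow>
     (AE \<omega> in M. L2_sums (\<lambda>l m. harm_coeff T l m \<omega>) (\<lambda>x. complex_of_real (T \<omega> x))) \<and>
     prob_space.indep_vars M (\<lambda>_. borel) (\<lambda>(l, k) \<omega>. harm_coeff T l (int k) \<omega>)
       {(l, k). k \<le> l} \<and>
     (\<forall>l. (\<forall>\<omega>\<in>space M. harm_coeff T l 0 \<omega> \<in> \<real>) \<and>
          distributed M lborel (\<lambda>\<omega>. Re (harm_coeff T l 0 \<omega>)) (normal_density 0 (sqrt (C l)))) \<and>
     (\<forall>l m. m \<noteq> 0 \<and> \<bar>m\<bar> \<le> int l \<longrightarrow>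
        prob_space.indep_var M borel (\<lambda>\<omega>. Re (harm_coeff T l m \<omega>))
          borel (\<lambda>\<omega>. Im (harm_coeff T l m \<omega>)) \<and>
        distributed M lborel (\<lambda>\<omega>. Re (harm_coeff T l m \<omega>)) (normal_density 0 (sqrt (C l / 2))) \<and>
        distributed M lborel (\<lambda>\<omega>. Im (harm_coeff T l m \<omega>)) (normal_density 0 (sqrt (C l / 2))))"

end

theory Submission
  imports Defs
begin

text \<open>The objective decouples over the coefficients, so its minimizer soft-thresholds the harmonic
  coefficients of \<open>T\<close>: \<open>a\<close> becomes \<open>(|a| - lam)\<^sub>+ * a / |a|\<close>. The coefficients are independent and
  \<open>\<Sum>(2 * l + 1) * C l\<close> converges, so with positive probability all of them are at most \<open>lam\<close>
  in modulus, and with positive probability exactly one prescribed coefficient exceeds it. Hence the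
  regularized field has an atom at \<open>0\<close> without being constant, which no Gaussian variable
  has, and the mass of that atom depends on the point of the sphere.

  The orthonormality of the spherical harmonics is not computed but follows from the spectral
  representation: a coefficient \<open>a\<^sub>j\<close> equals \<open>\<Sum>\<^sub>i a\<^sub>i * \<langle>Y\<^sub>i, Y\<^sub>j\<rangle>\<close> almost surely, and
  independence of the nondegenerate \<open>a\<^sub>i\<close> forces \<open>\<langle>Y\<^sub>i, Y\<^sub>j\<rangle> = \<delta>\<^sub>i\<^sub>j\<close>.\<close>


section \<open>Square-integrable functions\<close>

text \<open>Since \<open>T\<close> is real, the coefficients of orders \<open>k\<close> and
  \<open>-k\<close> determine each other, and only the orders \<open>k >= 0\<close> form an
  independent family; the probabilistic arguments therefore merge the two orders into one
  real-linear function of the coefficient of order \<open>k\<close>. By Bessel's inequality the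
  coefficients of a square-integrable realization tend to zero, so only finitely many survive the
  threshold. The regularized field is thus almost surely a finite harmonic sum, and its value at a
  single point is meaningful. Thresholding puts an atom at zero into the law of every coefficient,
  but it is injective above the level. This is why the argument that one term cannot cancel the
  others is restricted to the event that the singled-out coefficient is large. Realizations that are
  not square integrable form a null set on which the objective is constantly infinite. They still
  have to be controlled, because joint measurability of the field concerns every outcome.\<close>

definition square_integrable :: "'a measure \<Rightarrow> ('a \<Rightarrow> complex) \<Rightarrow> bool" where
  "square_integrable N f \<longleftrightarrow>
     f \<in> borel_measurable N \<and> integrable N (\<lambda>x. (cmod (f x))\<^sup>2)"

definition sq_norm :: "'a measure \<Rightarrow> ('a \<Rightarrow> complex) \<Rightarrow> real" where
  "sq_norm N f = (\<integral>x. (cmod (f x))\<^sup>2 \<partial>N)"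

lemma sq_norm_nonneg [simp]: "0 \<le> sq_norm N f"
  by (simp add: sq_norm_def)

lemma square_integrable_zero [simp]: "square_integrable N (\<lambda>x. 0)"
  by (simp add: square_integrable_def)

lemma square_integrable_cmult:
  assumes "square_integrable N f"
  shows "square_integrable N (\<lambda>x. c * f x)"
  using assms by (auto simp: square_integrable_def norm_mult power_mult_distrib)

lemma cmod_add_sq_le: "(cmod (a + b))\<^sup>2 \<le> 2 * (cmod a)\<^sup>2 + 2 * (cmod b)\<^sup>2"
proof -
  have "(cmod (a + b))\<^sup>2 \<le> (cmod a + cmod b)\<^sup>2"
    by (intro power_mono norm_triangle_ineq) auto
  also have "\<dots> \<le> 2 * (cmod a)\<^sup>2 + 2 * (cmod b)\<^sup>2"
    using sum_squares_bound[of "cmod a" "cmod b"] by (simp add: power2_sum)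
  finally show ?thesis .
qed

lemma square_integrable_add:
  assumes "square_integrable N f" "square_integrable N g"
  shows "square_integrable N (\<lambda>x. f x + g x)"
proof -
  have [measurable]: "f \<in> borel_measurable N" "g \<in> borel_measurable N"
    and int: "integrable N (\<lambda>x. 2 * (cmod (f x))\<^sup>2 + 2 * (cmod (g x))\<^sup>2)"
    using assms by (auto simp: square_integrable_def)
  have "integrable N (\<lambda>x. (cmod (f x + g x))\<^sup>2)"
    by (rule Bochner_Integration.integrable_bound[OF int]) (auto intro!: AE_I2 cmod_add_sq_le)
  then show ?thesis
    by (simp add: square_integrable_def)
qed

lemma square_integrable_diff:
  assumes "square_integrable N f" "square_integrable N g"
  shows "square_integrable N (\<lambda>x. f x - g x)"
  using square_integrable_add[OF assms(1) square_integrable_cmult[OF assms(2), of "-1"]] by simp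

lemma square_integrable_sum:
  assumes "\<And>i. i \<in> I \<Longrightarrow> square_integrable N (f i)"
  shows "square_integrable N (\<lambda>x. \<Sum>i\<in>I. f i x)"
  using assms by (induction I rule: infinite_finite_induct) (auto intro: square_integrable_add)

lemma borel_measurable_cnj [measurable]:
  "f \<in> borel_measurable N \<Longrightarrow> (\<lambda>x. cnj (f x)) \<in> borel_measurable N"
  by (rule borel_measurable_continuous_on[OF continuous_on_cnj[OF continuous_on_id]])

lemma integrable_mult_cnj:
  assumes "square_integrable N f" "square_integrable N g"
  shows "integrable N (\<lambda>x. f x * cnj (g x))"
proof -
  have [measurable]: "f \<in> borel_measurable N" "g \<in> borel_measurable N"
    and int: "integrable N (\<lambda>x. (cmod (f x))\<^sup>2 + (cmod (g x))\<^sup>2)"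
    using assms by (auto simp: square_integrable_def)
  have "cmod a * cmod b \<le> (cmod a)\<^sup>2 + (cmod b)\<^sup>2" for a b :: complex
    using sum_squares_bound[of "cmod a" "cmod b"] mult_nonneg_nonneg[of "cmod a" "cmod b"]
    by (simp del: mult_nonneg_nonneg)
  then show ?thesis
    by (intro Bochner_Integration.integrable_bound[OF int]) (auto intro!: AE_I2 simp: norm_mult)
qed

text \<open>Cauchy-Schwarz for extended nonnegative integrals, applied to the moduli; square
  integrability makes all the integrals finite, so the inequality descends to the reals.\<close>

lemma cmod_integral_mult_cnj_le:
  assumes "square_integrable N f" "square_integrable N g"
  shows "cmod (\<integral>x. f x * cnj (g x) \<partial>N) \<le> sqrt (sq_norm N f) * sqrt (sq_norm N g)"
proof -
  have [measurable]: "f \<in> borel_measurable N" "g \<in> borel_measurable N"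
    and int: "integrable N (\<lambda>x. (cmod (f x))\<^sup>2)" "integrable N (\<lambda>x. (cmod (g x))\<^sup>2)"
    using assms by (auto simp: square_integrable_def)
  define I where "I = (\<integral>x. cmod (f x) * cmod (g x) \<partial>N)"
  have "integrable N (\<lambda>x. cmod (f x) * cmod (g x))"
    using integrable_norm[OF integrable_mult_cnj[OF assms]] by (simp add: norm_mult)
  then have "(\<integral>\<^sup>+x. ennreal (cmod (f x)) * ennreal (cmod (g x)) \<partial>N) = ennreal I"
    by (subst nn_integral_eq_integral[symmetric] I_def)+ (auto simp: ennreal_mult)
  moreover have "(\<integral>\<^sup>+x. (ennreal (cmod (h x)))\<^sup>2 \<partial>N) = ennreal (sq_norm N h)"
    if "integrable N (\<lambda>x. (cmod (h x))\<^sup>2)" for h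
    using nn_integral_eq_integral[OF that] by (simp add: sq_norm_def ennreal_power)
  ultimately have "(ennreal I)\<^sup>2 \<le> ennreal (sq_norm N f) * ennreal (sq_norm N g)"
    using Cauchy_Schwarz_nn_integral[of "\<lambda>x. ennreal (cmod (f x))" N "\<lambda>x. ennreal (cmod (g x))"] int
    by simp
  moreover have "I \<ge> 0"
    by (simp add: I_def)
  ultimately have "I\<^sup>2 \<le> sq_norm N f * sq_norm N g"
    by (simp add: ennreal_power flip: ennreal_mult)
  then have "I \<le> sqrt (sq_norm N f) * sqrt (sq_norm N g)"
    by (simp add: real_le_rsqrt flip: real_sqrt_mult)
  moreover have "cmod (\<integral>x. f x * cnj (g x) \<partial>N) \<le> I"
    using integral_norm_bound[of N "\<lambda>x. f x * cnj (g x)"] by (simp add: I_def norm_mult)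
  ultimately show ?thesis by simp
qed

lemma cmod_add_sq: "(cmod (a + b))\<^sup>2 = (cmod a)\<^sup>2 + 2 * Re (a * cnj b) + (cmod b)\<^sup>2"
  unfolding cmod_power2 by (simp add: power2_eq_square algebra_simps)

lemma sq_norm_add:
  assumes f: "square_integrable N f" and g: "square_integrable N g"
  shows "sq_norm N (\<lambda>x. f x + g x)
       = sq_norm N f + 2 * Re (\<integral>x. f x * cnj (g x) \<partial>N) + sq_norm N g"
proof -
  note int = integrable_mult_cnj[OF f g]
  have "integrable N (\<lambda>x. (cmod (f x))\<^sup>2)" "integrable N (\<lambda>x. (cmod (g x))\<^sup>2)"
    using f g by (auto simp: square_integrable_def)
  moreover have "(\<integral>x. Re (f x * cnj (g x)) \<partial>N) = Re (\<integral>x. f x * cnj (g x) \<partial>N)"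
    by (rule integral_Re[OF int])
  moreover have "integrable N (\<lambda>x. Re (f x * cnj (g x)))"
    using int by (rule integrable_Re)
  ultimately show ?thesis
    unfolding sq_norm_def cmod_add_sq by (simp del: times_complex.sel)
qed

text \<open>A small perturbation in the mean-square sense changes \<open>sq_norm\<close> little;
  this is the continuity estimate behind \<open>tendsto_sq_norm\<close>.\<close>

lemma abs_sq_norm_add_diff_le:
  assumes f: "square_integrable N f" and g: "square_integrable N g"
  shows "\<bar>sq_norm N (\<lambda>x. f x + g x) - sq_norm N f\<bar>
       \<le> 2 * (sqrt (sq_norm N f) * sqrt (sq_norm N g)) + sq_norm N g"
  using cmod_integral_mult_cnj_le[OF f g] abs_Re_le_cmod[of "\<integral>x. f x * cnj (g x) \<partial>N"]
    sq_norm_nonneg[of N g]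
  unfolding sq_norm_add[OF f g] by linarith

lemma tendsto_integral_mult_cnj:
  assumes "square_integrable N f" "square_integrable N g" "\<And>n. square_integrable N (u n)"
    and "(\<lambda>n. sq_norm N (\<lambda>x. f x - u n x)) \<longlonglongrightarrow> 0"
  shows "(\<lambda>n. \<integral>x. u n x * cnj (g x) \<partial>N) \<longlonglongrightarrow> (\<integral>x. f x * cnj (g x) \<partial>N)"
proof -
  have d: "square_integrable N (\<lambda>x. f x - u n x)" for n
    by (intro square_integrable_diff assms)
  have "(\<lambda>n. sqrt (sq_norm N (\<lambda>x. f x - u n x)) * sqrt (sq_norm N g)) \<longlonglongrightarrow> 0"
    using tendsto_mult_left_zero[OF tendsto_real_sqrt[OF assms(4), unfolded real_sqrt_zero]] .
  then have "(\<lambda>n. \<integral>x. (f x - u n x) * cnj (g x) \<partial>N) \<longlonglongrightarrow> 0"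
    by (rule Lim_null_comparison[rotated])
       (intro always_eventually allI cmod_integral_mult_cnj_le d assms)
  then have "(\<lambda>n. (\<integral>x. f x * cnj (g x) \<partial>N) - (\<integral>x. u n x * cnj (g x) \<partial>N)) \<longlonglongrightarrow> 0"
    using integrable_mult_cnj[OF assms(1,2)] integrable_mult_cnj[OF assms(3,2)]
    by (simp add: left_diff_distrib)
  from tendsto_diff[OF tendsto_const[of "\<integral>x. f x * cnj (g x) \<partial>N"] this] show ?thesis
    by simp
qed

lemma tendsto_sq_norm:
  assumes "square_integrable N f" "\<And>n. square_integrable N (u n)"
    and "(\<lambda>n. sq_norm N (\<lambda>x. u n x - f x)) \<longlonglongrightarrow> 0"
  shows "(\<lambda>n. sq_norm N (u n)) \<longlonglongrightarrow> sq_norm N f"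
proof -
  have d: "square_integrable N (\<lambda>x. u n x - f x)" for n
    by (intro square_integrable_diff assms)
  have "(\<lambda>n. 2 * (sqrt (sq_norm N f) * sqrt (sq_norm N (\<lambda>x. u n x - f x)))
          + sq_norm N (\<lambda>x. u n x - f x)) \<longlonglongrightarrow> 2 * (sqrt (sq_norm N f) * sqrt 0) + 0"
    by (intro tendsto_intros assms)
  then have "(\<lambda>n. sq_norm N (u n) - sq_norm N f) \<longlonglongrightarrow> 0"
    using abs_sq_norm_add_diff_le[OF assms(1) d]
    by (intro Lim_null_comparison[of "\<lambda>n. sq_norm N (u n) - sq_norm N f"]) auto
  then show ?thesis
    by (simp add: LIM_zero_iff)
qed

text \<open>Completing the square, one index at a time. The array \<open>\<alpha>\<close> is left
  arbitrary so that the same identity yields both Bessel's inequality (\<open>\<alpha>\<close> equal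
  to the coefficients of \<open>f\<close>) and the decoupling of the objective.\<close>

lemma sq_norm_diff_orthonormal_sum:
  assumes "finite I" and f: "square_integrable N f"
    and e: "\<And>i. i \<in> I \<Longrightarrow> square_integrable N (e i)"
    and orth: "\<And>i j. i \<in> I \<Longrightarrow> j \<in> I \<Longrightarrow>
      (\<integral>x. e i x * cnj (e j x) \<partial>N) = (if i = j then 1 else 0)"
  shows "sq_norm N (\<lambda>x. f x - (\<Sum>i\<in>I. \<alpha> i * e i x)) = sq_norm N f +
    (\<Sum>i\<in>I. (cmod ((\<integral>x. f x * cnj (e i x) \<partial>N) - \<alpha> i))\<^sup>2
          - (cmod (\<integral>x. f x * cnj (e i x) \<partial>N))\<^sup>2)"
  using assms(1) e orth
proof (induction I rule: finite_induct)
  case empty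
  then show ?case by simp
next
  case (insert i I)
  define c where "c = (\<integral>x. f x * cnj (e i x) \<partial>N)"
  define h where "h x = f x - (\<Sum>j\<in>I. \<alpha> j * e j x)" for x
  have h: "square_integrable N h"
    unfolding h_def using insert.prems
    by (intro square_integrable_diff f square_integrable_sum square_integrable_cmult) auto
  have ei: "square_integrable N (e i)"
    using insert.prems by auto
  \<comment> \<open>The terms already subtracted are orthogonal to \<open>e i\<close>, so
    \<open>h\<close> and \<open>f\<close> have the same coefficient along
    \<open>e i\<close>.\<close>
  have "(\<integral>x. h x * cnj (e i x) \<partial>N)
      = (\<integral>x. f x * cnj (e i x) - (\<Sum>j\<in>I. \<alpha> j * (e j x * cnj (e i x))) \<partial>N)"
    by (simp add: h_def left_diff_distrib sum_distrib_right mult.assoc)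
  also have "\<dots> = c - (\<Sum>j\<in>I. \<alpha> j * (\<integral>x. e j x * cnj (e i x) \<partial>N))"
  proof -
    have j: "integrable N (\<lambda>x. \<alpha> j * (e j x * cnj (e i x)))" if "j \<in> I" for j
      using that insert.prems(1) by (intro integrable_mult_right integrable_mult_cnj) auto
    have "integrable N (\<lambda>x. f x * cnj (e i x))"
      by (intro integrable_mult_cnj f ei)
    then have "(\<integral>x. f x * cnj (e i x) - (\<Sum>j\<in>I. \<alpha> j * (e j x * cnj (e i x))) \<partial>N)
        = c - (\<integral>x. (\<Sum>j\<in>I. \<alpha> j * (e j x * cnj (e i x))) \<partial>N)"
      unfolding c_def by (intro Bochner_Integration.integral_diff Bochner_Integration.integrable_sum j)
    then show ?thesis
      by (simp only: Bochner_Integration.integral_sum[OF j] integral_mult_right_zero)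
  qed
  also have "(\<Sum>j\<in>I. \<alpha> j * (\<integral>x. e j x * cnj (e i x) \<partial>N)) = 0"
    using insert.prems insert.hyps by (intro sum.neutral) auto
  finally have hc: "(\<integral>x. h x * cnj (e i x) \<partial>N) = c" by simp
  have "complex_of_real (sq_norm N (e i)) = (\<integral>x. e i x * cnj (e i x) \<partial>N)"
    by (simp only: sq_norm_def integral_complex_of_real[symmetric] complex_norm_square)
  also have "\<dots> = 1" using insert.prems by simp
  finally have "sq_norm N (e i) = 1" by simp
  then have e1: "sq_norm N (\<lambda>x. - \<alpha> i * e i x) = (cmod (\<alpha> i))\<^sup>2"
    by (simp add: sq_norm_def norm_mult power_mult_distrib)
  have "sq_norm N (\<lambda>x. f x - (\<Sum>j\<in>insert i I. \<alpha> j * e j x)) = sq_norm N (\<lambda>x. h x + (- \<alpha> i * e i x))"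
    using insert.hyps by (simp add: h_def algebra_simps)
  also have "\<dots> = sq_norm N h + 2 * Re (\<integral>x. h x * cnj (- \<alpha> i * e i x) \<partial>N) + (cmod (\<alpha> i))\<^sup>2"
    by (simp only: sq_norm_add[OF h square_integrable_cmult[OF ei]] e1)
  also have "(\<integral>x. h x * cnj (- \<alpha> i * e i x) \<partial>N) = (\<integral>x. - cnj (\<alpha> i) * (h x * cnj (e i x)) \<partial>N)"
    by (simp add: mult_ac)
  also have "\<dots> = - cnj (\<alpha> i) * c"
    by (simp only: integral_mult_right_zero hc)
  also have "sq_norm N h + 2 * Re (- cnj (\<alpha> i) * c) + (cmod (\<alpha> i))\<^sup>2
      = sq_norm N h + ((cmod (c - \<alpha> i))\<^sup>2 - (cmod c)\<^sup>2)"
    unfolding cmod_power2 by (simp add: power2_eq_square algebra_simps)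
  finally show ?case
    using insert by (simp add: h_def[abs_def] c_def algebra_simps)
qed

text \<open>With \<open>c\<^sub>l > \<parallel>g\<^sub>l\<parallel>\<close> summable and \<open>q\<^sub>l = |g\<^sub>l|\<^sup>2 / c\<^sub>l\<close>, Cauchy-Schwarz gives
  \<open>(\<Sum>|g\<^sub>l|)\<^sup>2 \<le> \<Sum>c\<^sub>l * \<Sum>q\<^sub>l\<close>, an integrable bound for dominated convergence.\<close>

lemma square_integrable_series:
  assumes g: "\<And>l. square_integrable N (g l)"
    and sum: "summable (\<lambda>l::nat. sqrt (sq_norm N (g l)))"
  obtains f where "square_integrable N f"
    "(\<lambda>L. sq_norm N (\<lambda>x. f x - (\<Sum>l\<le>L. g l x))) \<longlonglongrightarrow> 0"
proof -
  have [measurable]: "g l \<in> borel_measurable N" for l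
    using g by (simp add: square_integrable_def)
  have gint: "integrable N (\<lambda>x. (cmod (g l x))\<^sup>2)" for l
    using g by (simp add: square_integrable_def)
  \<comment> \<open>The geometric summand keeps \<open>c l\<close> positive when \<open>g l\<close>
    has norm zero, so that \<open>q l\<close> may divide by it, and it does not affect
    summability.\<close>
  define c where "c l = sqrt (sq_norm N (g l)) + (1/2) ^ l" for l
  have c_pos: "c l > 0" for l
    by (simp add: c_def add_nonneg_pos)
  have c_sum: "summable c"
    unfolding c_def by (intro summable_add sum summable_geometric) simp
  define q where "q l x = (cmod (g l x))\<^sup>2 / c l" for l x
  have [measurable]: "q l \<in> borel_measurable N" for l
    unfolding q_def by measurable
  have q_nonneg: "q l x \<ge> 0" for l x
    using c_pos[of l] by (simp add: q_def)
  have q_int: "integrable N (q l)" for l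
    unfolding q_def using gint by auto
  have q_le: "(\<integral>x. q l x \<partial>N) \<le> c l" for l
  proof -
    have "(\<integral>x. q l x \<partial>N) = sq_norm N (g l) / c l"
      by (simp add: q_def sq_norm_def)
    also have "sq_norm N (g l) = (sqrt (sq_norm N (g l)))\<^sup>2" by simp
    also have "\<dots> \<le> (c l)\<^sup>2" by (intro power_mono) (auto simp: c_def)
    finally show ?thesis using c_pos[of l]
      by (simp add: divide_le_eq power2_eq_square divide_right_mono)
  qed
  have q_summable_int: "summable (\<lambda>l. \<integral>x. norm (q l x) \<partial>N)"
    by (rule summable_comparison_test'[OF c_sum, of 0]) (use q_le q_nonneg in auto)
  have q_AE: "AE x in N. summable (\<lambda>l. q l x)"
  proof -
    have "(\<integral>\<^sup>+x. (\<Sum>l. ennreal (q l x)) \<partial>N) = (\<Sum>l. \<integral>\<^sup>+x. ennreal (q l x) \<partial>N)"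
      by (intro nn_integral_suminf) auto
    also have "\<dots> = (\<Sum>l. ennreal (\<integral>x. q l x \<partial>N))"
      by (intro suminf_cong nn_integral_eq_integral q_int AE_I2 q_nonneg)
    also have "\<dots> < \<infinity>"
      using q_summable_int q_nonneg by (simp add: suminf_ennreal2 less_top integral_nonneg)
    finally have "AE x in N. (\<Sum>l. ennreal (q l x)) \<noteq> \<infinity>"
      by (intro nn_integral_PInf_AE) auto
    then show ?thesis
      by eventually_elim (auto intro: summable_suminf_not_top q_nonneg)
  qed
  define f where "f x = (\<Sum>l. g l x)" for x
  define D where "D x = (\<Sum>l. c l) * (\<Sum>l. q l x)" for x
  have [measurable]: "f \<in> borel_measurable N" "D \<in> borel_measurable N"
    unfolding f_def[abs_def] D_def[abs_def] by measurable
  have D_int: "integrable N D"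
    unfolding D_def
    by (intro integrable_mult_right integrable_suminf q_int q_summable_int) (use q_AE q_nonneg in auto)
  have partial: "(\<Sum>l\<in>A. cmod (g l x))\<^sup>2 \<le> D x" if "summable (\<lambda>l. q l x)" "finite A" for A x
  proof -
    have "(\<Sum>l\<in>A. cmod (g l x))\<^sup>2 = (\<Sum>l\<in>A. sqrt (c l) * (cmod (g l x) / sqrt (c l)))\<^sup>2"
      using c_pos by (intro arg_cong[where f = "\<lambda>s. s\<^sup>2"] sum.cong) (auto simp: less_imp_neq[symmetric])
    also have "\<dots> \<le> (\<Sum>l\<in>A. (sqrt (c l))\<^sup>2) * (\<Sum>l\<in>A. (cmod (g l x) / sqrt (c l))\<^sup>2)"
      by (rule Cauchy_Schwarz_ineq_sum)
    also have "\<dots> = (\<Sum>l\<in>A. c l) * (\<Sum>l\<in>A. q l x)"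
      using c_pos by (simp add: q_def power_divide less_imp_le)
    also have "\<dots> \<le> D x"
      unfolding D_def using c_pos that q_nonneg
      by (intro mult_mono sum_le_suminf c_sum suminf_nonneg sum_nonneg) (auto simp: less_imp_le)
    finally show ?thesis .
  qed
  have ptwise: "(\<lambda>L. (cmod (f x - (\<Sum>l\<le>L. g l x)))\<^sup>2) \<longlonglongrightarrow> 0 \<and> (cmod (f x))\<^sup>2 \<le> D x
        \<and> (\<forall>L. (cmod (f x - (\<Sum>l\<le>L. g l x)))\<^sup>2 \<le> D x)"
    if q: "summable (\<lambda>l. q l x)" for x
  proof -
    have "summable (\<lambda>l. cmod (g l x))"
    proof (rule summableI_nonneg_bounded)
      show "(\<Sum>l<n. cmod (g l x)) \<le> sqrt (D x)" for n
        using partial[OF q, of "{..<n}"] by (intro real_le_rsqrt) auto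
    qed auto
    then have "summable (\<lambda>l. g l x)" by (rule summable_norm_cancel)
    then have "(\<lambda>L. \<Sum>l\<le>L. g l x) \<longlonglongrightarrow> f x"
      unfolding f_def by (rule summable_LIMSEQ')
    then have lim: "(\<lambda>L. \<Sum>l\<le>L. g l x) \<longlonglongrightarrow> f x" .
    have "(\<lambda>L. (cmod (f x - (\<Sum>l\<le>L. g l x)))\<^sup>2) \<longlonglongrightarrow> (cmod (f x - f x))\<^sup>2"
      by (intro tendsto_intros lim)
    \<comment> \<open>Allowing \<open>A = {}\<close> besides initial segments gives the bound on
      \<open>f\<close> itself together with the bound on the remainders.\<close>
    moreover have tail: "(cmod (f x - (\<Sum>l\<in>A. g l x)))\<^sup>2 \<le> D x"
      if A: "A = {} \<or> (\<exists>L. A = {..L})" for A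
    proof (rule LIMSEQ_le_const2)
      show "(\<lambda>n. (cmod ((\<Sum>l\<le>n. g l x) - (\<Sum>l\<in>A. g l x)))\<^sup>2) \<longlonglongrightarrow> (cmod (f x - (\<Sum>l\<in>A. g l x)))\<^sup>2"
        by (intro tendsto_intros lim)
      obtain n0 where "A \<subseteq> {..n0}" using A by auto
      show "\<exists>n0. \<forall>n\<ge>n0. (cmod ((\<Sum>l\<le>n. g l x) - (\<Sum>l\<in>A. g l x)))\<^sup>2 \<le> D x"
      proof (intro exI allI impI)
        fix n assume "n \<ge> n0"
        then have "A \<subseteq> {..n}" using \<open>A \<subseteq> {..n0}\<close> by (meson atMost_subset_iff order_trans)
        then have "(\<Sum>l\<le>n. g l x) - (\<Sum>l\<in>A. g l x) = (\<Sum>l\<in>{..n} - A. g l x)"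
          by (simp add: sum_diff)
        also have "(cmod \<dots>)\<^sup>2 \<le> (\<Sum>l\<in>{..n} - A. cmod (g l x))\<^sup>2"
          by (intro power_mono norm_sum) auto
        also have "\<dots> \<le> D x" by (intro partial q) auto
        finally show "(cmod ((\<Sum>l\<le>n. g l x) - (\<Sum>l\<in>A. g l x)))\<^sup>2 \<le> D x" .
      qed
    qed
    moreover have "(cmod (f x))\<^sup>2 \<le> D x" using tail[of "{}"] by simp
    ultimately show ?thesis by auto
  qed
  have "integrable N (\<lambda>x. (cmod (f x))\<^sup>2)"
    by (rule Bochner_Integration.integrable_bound[OF D_int])
       (use q_AE in \<open>auto elim!: eventually_mono dest!: ptwise intro: order_trans\<close>)
  then have "square_integrable N f"
    by (simp add: square_integrable_def)
  moreover have "(\<lambda>L. sq_norm N (\<lambda>x. f x - (\<Sum>l\<le>L. g l x))) \<longlonglongrightarrow> (\<integral>x. 0 \<partial>N)"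
    unfolding sq_norm_def
  proof (rule integral_dominated_convergence[OF _ _ D_int])
    show "AE x in N. (\<lambda>L. (cmod (f x - (\<Sum>l\<le>L. g l x)))\<^sup>2) \<longlonglongrightarrow> 0"
      using q_AE by eventually_elim (use ptwise in auto)
    show "AE x in N. norm ((cmod (f x - (\<Sum>l\<le>L. g l x)))\<^sup>2) \<le> D x" for L
      using q_AE by eventually_elim (use ptwise in auto)
  qed auto
  ultimately show ?thesis using that by simp
qed

section \<open>Spherical harmonics\<close>

lemma sets_sphere_measure [measurable_cong]: "sets sphere_measure = sets (restrict_space borel S2)"
  by (simp add: sphere_measure_def)

lemma space_sphere_measure [simp]: "space sphere_measure = S2"
  by (simp add: sphere_measure_def space_restrict_space space_scale_measure)

text \<open>Radial projection maps the whole punctured ball into the sphere, so the total mass is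
  three times the volume of that ball. Finiteness makes bounded measurable functions square
  integrable and supplies the sigma-finiteness for integrals that depend on a parameter.\<close>

interpretation sphere: finite_measure sphere_measure
proof
  define N where "N = restrict_space lborel (ball 0 1 - {0 :: real^3})"
  have "(\<lambda>x :: real^3. x /\<^sub>R norm x) \<in> borel_measurable N"
    unfolding N_def by (intro measurable_restrict_space1) measurable
  then have meas: "(\<lambda>x. x /\<^sub>R norm x) \<in> measurable N (restrict_space borel S2)"
    by (intro measurable_restrict_space2) (auto simp: N_def space_restrict_space)
  have "emeasure sphere_measure (space sphere_measure)
      = 3 * emeasure (distr N (restrict_space borel S2) (\<lambda>x. x /\<^sub>R norm x))
          (space (distr N (restrict_space borel S2) (\<lambda>x. x /\<^sub>R norm x)))"
    by (simp add: sphere_measure_def N_def space_restrict_space space_scale_measure)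
  also have "\<dots> = 3 * emeasure N (space N)"
  proof -
    have "(\<lambda>x. x /\<^sub>R norm x) -` space (restrict_space borel S2) \<inter> space N = space N"
      using measurable_space[OF meas] by blast
    then show ?thesis
      by (simp only: space_distr emeasure_distr[OF meas sets.top])
  qed
  finally have eq: "emeasure sphere_measure (space sphere_measure) = 3 * emeasure N (space N)" .
  have "emeasure N (space N) \<le> emeasure lborel (ball 0 1 :: (real^3) set)"
    unfolding N_def by (auto simp: emeasure_restrict_space space_restrict_space intro!: emeasure_mono)
  also have "\<dots> < \<infinity>"
    by (intro emeasure_bounded_finite bounded_ball)
  finally show "emeasure sphere_measure (space sphere_measure) \<noteq> \<infinity>"
    unfolding eq by (simp add: ennreal_mult_eq_top_iff)
qed

lemma continuous_on_sph_harm: "continuous_on A (sph_harm l m)"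
proof -
  have "Complex (x $ 1) (x $ 2) = of_real (x $ 1) + \<i> * of_real (x $ 2)" for x :: "real^3"
    by (simp add: complex_eq_iff)
  then have "continuous_on A (sph_harm_nonneg l k)" for k
    unfolding sph_harm_nonneg_def[abs_def] by (auto intro!: continuous_intros)
  then show ?thesis
    unfolding sph_harm_def[abs_def] by (cases "0 \<le> m") (auto intro!: continuous_intros)
qed

lemma borel_measurable_sph_harm [measurable]: "sph_harm l m \<in> borel_measurable borel"
  by (intro borel_measurable_continuous_onI continuous_on_sph_harm)

lemma borel_measurable_sph_harm' [measurable]: "sph_harm l m \<in> borel_measurable sphere_measure"
  by (subst measurable_cong_sets[OF sets_sphere_measure refl])
     (intro measurable_restrict_space1 borel_measurable_sph_harm)

lemma square_integrable_sph_harm: "square_integrable sphere_measure (sph_harm l m)"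
proof -
  have "compact (sph_harm l m ` S2)"
    by (intro compact_continuous_image continuous_on_sph_harm compact_sphere)
  then obtain B where B: "\<And>x. x \<in> S2 \<Longrightarrow> cmod (sph_harm l m x) \<le> B"
    by (meson bounded_iff compact_imp_bounded imageI)
  have "integrable sphere_measure (\<lambda>x. (cmod (sph_harm l m x))\<^sup>2)"
    by (rule sphere.integrable_const_bound[of _ "B\<^sup>2"])
       (auto intro!: AE_I2 power_mono B)
  then show ?thesis
    by (simp add: square_integrable_def)
qed

lemma sph_harm_minus: "sph_harm l (- m) x = (-1) ^ nat \<bar>m\<bar> * cnj (sph_harm l m x)"
proof -
  have "(-1 :: complex) ^ k * ((-1) ^ k * z) = z" for k z
    by (simp flip: mult.assoc power_mult_distrib)
  then show ?thesis
    by (cases m "0 :: int" rule: linorder_cases) (simp_all add: sph_harm_def sph_harm_nonneg_def)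
qed

lemma L2_norm_S2_eq:
  assumes "square_integrable sphere_measure f"
  shows "L2_norm_S2 f = ennreal (sqrt (sq_norm sphere_measure f))"
proof -
  have "(\<integral>\<^sup>+x. ennreal ((cmod (f x))\<^sup>2) \<partial>sphere_measure) = ennreal (sq_norm sphere_measure f)"
    unfolding sq_norm_def using assms
    by (intro nn_integral_eq_integral) (auto simp: square_integrable_def)
  then show ?thesis
    by (simp add: L2_norm_S2_def)
qed

lemma L2_norm_S2_eq_top:
  assumes "f \<in> borel_measurable sphere_measure" "\<not> square_integrable sphere_measure f"
  shows "L2_norm_S2 f = \<infinity>"
proof -
  have "\<not> (\<integral>\<^sup>+x. ennreal ((cmod (f x))\<^sup>2) \<partial>sphere_measure) < \<infinity>"
    using assms by (auto simp: square_integrable_def integrable_iff_bounded)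
  then show ?thesis
    by (auto simp: L2_norm_S2_def Let_def less_top)
qed

lemma square_integrable_harmonic_sum:
  "square_integrable sphere_measure (\<lambda>x. \<Sum>l\<in>A. \<Sum>m\<in>B l. \<alpha> l m * sph_harm l m x)"
  by (intro square_integrable_sum square_integrable_cmult square_integrable_sph_harm)

text \<open>Square integrability of the limit is forced: the partial sums are square integrable, so
  otherwise every distance would be infinite and could not tend to zero.\<close>

lemma L2_sums_iff:
  "L2_sums \<alpha> f \<longleftrightarrow> square_integrable sphere_measure f \<and>
     (\<lambda>L. sq_norm sphere_measure
       (\<lambda>x. f x - (\<Sum>l\<le>L. \<Sum>m\<in>{- int l..int l}. \<alpha> l m * sph_harm l m x))) \<longlonglongrightarrow> 0"
proof -
  let ?S = "\<lambda>L x. \<Sum>l\<le>L. \<Sum>m\<in>{- int l..int l}. \<alpha> l m * sph_harm l m x"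
  have S: "square_integrable sphere_measure (?S L)" for L
    by (rule square_integrable_harmonic_sum)
  have si: "square_integrable sphere_measure f" if "L2_sums \<alpha> f"
  proof (rule ccontr)
    assume not: "\<not> square_integrable sphere_measure f"
    have "L2_norm_S2 (\<lambda>x. f x - ?S L x) = \<infinity>" for L
    proof (rule L2_norm_S2_eq_top)
      show "(\<lambda>x. f x - ?S L x) \<in> borel_measurable sphere_measure"
        using that S[of L] by (auto simp: L2_sums_def square_integrable_def)
      show "\<not> square_integrable sphere_measure (\<lambda>x. f x - ?S L x)"
        using square_integrable_add[OF _ S[of L], of "\<lambda>x. f x - ?S L x"] not by auto
    qed
    then show False
      using that by (simp add: L2_sums_def LIMSEQ_const_iff)
  qed
  have "(\<lambda>L. L2_norm_S2 (\<lambda>x. f x - ?S L x)) \<longlonglongrightarrow> 0 \<longleftrightarrow>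
      (\<lambda>L. sq_norm sphere_measure (\<lambda>x. f x - ?S L x)) \<longlonglongrightarrow> 0"
    if f: "square_integrable sphere_measure f"
  proof -
    have "L2_norm_S2 (\<lambda>x. f x - ?S L x) = ennreal (sqrt (sq_norm sphere_measure (\<lambda>x. f x - ?S L x)))" for L
      by (intro L2_norm_S2_eq square_integrable_diff f S)
    moreover have "(\<lambda>L. sqrt (r L)) \<longlonglongrightarrow> 0 \<longleftrightarrow> r \<longlonglongrightarrow> 0"
      if "\<And>L. r L \<ge> 0" for r :: "nat \<Rightarrow> real"
      using tendsto_real_sqrt[of r 0 sequentially] tendsto_power[of "\<lambda>L. sqrt (r L)" 0 sequentially 2] that
      by auto
    ultimately show ?thesis
      by (simp add: ennreal_tendsto_0_iff)
  qed
  then show ?thesis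
    using si by (auto simp: L2_sums_def square_integrable_def)
qed

section \<open>The penalized minimization problem\<close>

text \<open>The proximal map of \<open>lam * cmod\<close>. For \<open>lam > 0\<close> the first
  branch covers \<open>z = 0\<close>, so the quotient is only used with a nonzero
  denominator.\<close>

definition soft_threshold :: "real \<Rightarrow> complex \<Rightarrow> complex" where
  "soft_threshold lam z = (if cmod z \<le> lam then 0 else of_real (1 - lam / cmod z) * z)"

text \<open>The residual \<open>g = z - s\<close> is a subgradient: \<open>|g| \<le> lam\<close> and \<open>\<langle>g, s\<rangle> = lam * |s|\<close>.\<close>

lemma soft_threshold_minimizes:
  assumes "lam > 0" and ne: "w \<noteq> soft_threshold lam z"
  shows "lam * cmod (soft_threshold lam z) + (cmod (z - soft_threshold lam z))\<^sup>2 / 2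
       < lam * cmod w + (cmod (z - w))\<^sup>2 / 2"
proof -
  define s where "s = soft_threshold lam z"
  define g where "g = z - s"
  have "cmod g \<le> lam \<and> Re (g * cnj s) = lam * cmod s"
  proof (cases "cmod z \<le> lam")
    case True
    then show ?thesis by (simp add: g_def s_def soft_threshold_def)
  next
    case False
    then have z: "cmod z > lam" "cmod z > 0" using \<open>lam > 0\<close> by auto
    have s: "s = of_real (1 - lam / cmod z) * z" and g: "g = of_real (lam / cmod z) * z"
      using False by (auto simp: s_def g_def soft_threshold_def algebra_simps)
    have "cmod g = lam" unfolding g norm_mult norm_of_real using z \<open>lam > 0\<close> by simp
    moreover have "cmod s = cmod z - lam"
      unfolding s norm_mult norm_of_real using z by (simp add: field_simps)
    moreover have "g * cnj s = of_real (lam / cmod z * (1 - lam / cmod z) * (cmod z)\<^sup>2)"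
      unfolding g s
      by (simp only: complex_cnj_mult complex_cnj_complex_of_real of_real_mult complex_norm_square mult_ac)
    moreover have "lam / cmod z * (1 - lam / cmod z) * (cmod z)\<^sup>2 = lam * (cmod z - lam)"
      using z by (simp add: field_simps power2_eq_square)
    ultimately show ?thesis by simp
  qed
  then have g: "cmod g \<le> lam" "Re (g * cnj s) = lam * cmod s" by auto
  have "Re (g * cnj w) \<le> cmod g * cmod w"
    using complex_Re_le_cmod[of "g * cnj w"] by (simp add: norm_mult)
  also have "\<dots> \<le> lam * cmod w"
    by (intro mult_right_mono g) auto
  finally have "Re (g * cnj w) \<le> lam * cmod w" .
  \<comment> \<open>Expanding the square around \<open>s\<close> shows that the objective at
    \<open>w\<close> exceeds the one at \<open>s\<close> by at least half of
    \<open>(cmod (s - w))\<^sup>2\<close>, which gives strictness.\<close>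
  moreover have "(cmod (z - w))\<^sup>2 = (cmod g)\<^sup>2 + 2 * (Re (g * cnj s) - Re (g * cnj w)) + (cmod (s - w))\<^sup>2"
    using cmod_add_sq[of g "s - w"] by (simp add: g_def algebra_simps)
  moreover have "(cmod (s - w))\<^sup>2 > 0" using ne by (simp add: s_def)
  ultimately show ?thesis
    unfolding s_def[symmetric] g_def[symmetric] using g by argo
qed

definition sph_coeff :: "(real^3 \<Rightarrow> complex) \<Rightarrow> nat \<Rightarrow> int \<Rightarrow> complex" where
  "sph_coeff f l m = (\<integral>x. f x * cnj (sph_harm l m x) \<partial>sphere_measure)"

definition soft_array :: "real \<Rightarrow> (nat \<Rightarrow> int \<Rightarrow> complex) \<Rightarrow> nat \<Rightarrow> int \<Rightarrow> complex" where
  "soft_array lam a l m = (if \<bar>m\<bar> \<le> int l then soft_threshold lam (a l m) else 0)"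

text \<open>Orthonormality is isolated as an assumption so that the deterministic minimization can
  be treated before any probability; \<open>spectral_field\<close> later discharges it.\<close>

locale orthonormal_harmonics =
  assumes orthonormal: "\<And>l m l' m'. \<bar>m\<bar> \<le> int l \<Longrightarrow> \<bar>m'\<bar> \<le> int l' \<Longrightarrow>
    sph_coeff (sph_harm l m) l' m' = (if l = l' \<and> m = m' then 1 else 0)"
begin

lemma sq_norm_diff_harmonic_sum:
  assumes "square_integrable sphere_measure f" "finite A"
  shows "sq_norm sphere_measure
      (\<lambda>x. f x - (\<Sum>l\<in>A. \<Sum>m\<in>{- int l..int l}. \<alpha> l m * sph_harm l m x))
    = sq_norm sphere_measure f + (\<Sum>l\<in>A. \<Sum>m\<in>{- int l..int l}.
        (cmod (sph_coeff f l m - \<alpha> l m))\<^sup>2 - (cmod (sph_coeff f l m))\<^sup>2)"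
proof -
  let ?I = "SIGMA l:A. {- int l..int l}"
  have "sq_norm sphere_measure (\<lambda>x. f x - (\<Sum>i\<in>?I. \<alpha> (fst i) (snd i) * sph_harm (fst i) (snd i) x))
    = sq_norm sphere_measure f + (\<Sum>i\<in>?I.
        (cmod (sph_coeff f (fst i) (snd i) - \<alpha> (fst i) (snd i)))\<^sup>2 - (cmod (sph_coeff f (fst i) (snd i)))\<^sup>2)"
    unfolding sph_coeff_def
  proof (rule sq_norm_diff_orthonormal_sum)
    fix i j assume "i \<in> ?I" "j \<in> ?I"
    then show "(\<integral>x. sph_harm (fst i) (snd i) x * cnj (sph_harm (fst j) (snd j) x) \<partial>sphere_measure)
        = (if i = j then 1 else 0)"
      using orthonormal[of "snd i" "fst i" "snd j" "fst j"]
      by (auto simp: sph_coeff_def prod_eq_iff abs_le_iff)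
  qed (use assms in \<open>auto intro: square_integrable_sph_harm\<close>)
  moreover have "(\<Sum>i\<in>?I. \<alpha> (fst i) (snd i) * sph_harm (fst i) (snd i) x)
      = (\<Sum>l\<in>A. \<Sum>m\<in>{- int l..int l}. \<alpha> l m * sph_harm l m x)" for x
    using \<open>finite A\<close> by (simp add: sum.Sigma split_def)
  moreover have "(\<Sum>i\<in>?I. (cmod (sph_coeff f (fst i) (snd i) - \<alpha> (fst i) (snd i)))\<^sup>2
        - (cmod (sph_coeff f (fst i) (snd i)))\<^sup>2)
      = (\<Sum>l\<in>A. \<Sum>m\<in>{- int l..int l}. (cmod (sph_coeff f l m - \<alpha> l m))\<^sup>2 - (cmod (sph_coeff f l m))\<^sup>2)"
    using \<open>finite A\<close> by (simp add: sum.Sigma split_def)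
  ultimately show ?thesis by (simp only:)
qed

text \<open>Taking the array to be the coefficients of \<open>f\<close> makes the first square
  vanish, and the residual on the left is nonnegative.\<close>

lemma bessel:
  assumes "square_integrable sphere_measure f"
  shows "summable (\<lambda>l. \<Sum>m\<in>{- int l..int l}. (cmod (sph_coeff f l m))\<^sup>2)"
proof (rule summableI_nonneg_bounded)
  show "(\<Sum>l<n. \<Sum>m\<in>{- int l..int l}. (cmod (sph_coeff f l m))\<^sup>2) \<le> sq_norm sphere_measure f" for n
    using sq_norm_diff_harmonic_sum[OF assms, of "{..<n}" "sph_coeff f"]
      sq_norm_nonneg[of sphere_measure "\<lambda>x. f x - (\<Sum>l<n. \<Sum>m\<in>{- int l..int l}. sph_coeff f l m * sph_harm l m x)"]
    by (simp add: sum_negf)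
qed (auto intro: sum_nonneg)

text \<open>By orthonormality the block of degree \<open>l\<close> has norm equal to the l2 norm of
  its coefficients, which is at most their l1 norm. Hence the block norms are summable, a limit
  exists, and the choice in \<open>L2_sum\<close> has a witness.\<close>

lemma L2_sums_L2_sum:
  assumes "array_l1_norm \<alpha> < \<infinity>"
  shows "L2_sums \<alpha> (L2_sum \<alpha>)"
proof -
  define g where "g l x = (\<Sum>m\<in>{- int l..int l}. \<alpha> l m * sph_harm l m x)" for l x
  have g: "square_integrable sphere_measure (g l)" for l
    unfolding g_def by (intro square_integrable_sum square_integrable_cmult square_integrable_sph_harm)
  have "array_l1_norm \<alpha> = (\<Sum>l. ennreal (\<Sum>m\<in>{- int l..int l}. cmod (\<alpha> l m)))"
    unfolding array_l1_norm_def by (intro suminf_cong) (simp add: sum_ennreal)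
  then have l1: "summable (\<lambda>l. \<Sum>m\<in>{- int l..int l}. cmod (\<alpha> l m))"
    using assms by (intro summable_suminf_not_top) (auto intro: sum_nonneg)
  have "sqrt (sq_norm sphere_measure (g l)) \<le> (\<Sum>m\<in>{- int l..int l}. cmod (\<alpha> l m))" for l
  proof -
    have "sq_norm sphere_measure (g l) = sq_norm sphere_measure (\<lambda>x. 0 - g l x)"
      by (simp add: sq_norm_def)
    also have "\<dots> = (\<Sum>m\<in>{- int l..int l}. (cmod (\<alpha> l m))\<^sup>2)"
      using sq_norm_diff_harmonic_sum[of "\<lambda>x. 0" "{l}" \<alpha>]
      by (simp add: g_def sph_coeff_def) (simp add: sq_norm_def)
    finally show ?thesis
      by (metis L2_set_def L2_set_le_sum norm_ge_zero)
  qed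
  then have "summable (\<lambda>l. sqrt (sq_norm sphere_measure (g l)))"
    by (intro summable_comparison_test'[OF l1, of 0]) auto
  with g obtain f where "square_integrable sphere_measure f"
    "(\<lambda>L. sq_norm sphere_measure (\<lambda>x. f x - (\<Sum>l\<le>L. g l x))) \<longlonglongrightarrow> 0"
    by (rule square_integrable_series)
  then have "L2_sums \<alpha> f"
    by (simp add: L2_sums_iff g_def)
  then show ?thesis
    unfolding L2_sum_def by (rule someI[where P = "L2_sums \<alpha>"])
qed

lemma l1_objective_eq_top:
  assumes "lam > 0" "f \<in> borel_measurable sphere_measure" "\<not> square_integrable sphere_measure f"
  shows "l1_objective lam f \<alpha> = \<infinity>"
proof (cases "array_l1_norm \<alpha> < \<infinity>")
  case True
  then have S: "square_integrable sphere_measure (L2_sum \<alpha>)"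
    using L2_sums_L2_sum by (simp add: L2_sums_iff)
  have "L2_norm_S2 (\<lambda>x. f x - L2_sum \<alpha> x) = \<infinity>"
  proof (rule L2_norm_S2_eq_top)
    show "(\<lambda>x. f x - L2_sum \<alpha> x) \<in> borel_measurable sphere_measure"
      using assms S by (auto simp: square_integrable_def)
    show "\<not> square_integrable sphere_measure (\<lambda>x. f x - L2_sum \<alpha> x)"
      using square_integrable_add[OF _ S, of "\<lambda>x. f x - L2_sum \<alpha> x"] assms by auto
  qed
  then show ?thesis
    by (simp add: l1_objective_def divide_ennreal_def power2_eq_square ennreal_top_mult)
next
  case False
  then show ?thesis
    using assms by (simp add: l1_objective_def ennreal_mult_top flip: less_top)
qed

text \<open>Each summand involves a single coefficient of \<open>\<alpha>\<close>. Subtracting half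
  the squared modulus of the coefficient of \<open>f\<close> does not depend on
  \<open>\<alpha>\<close>, and whatever part of \<open>f\<close> is orthogonal to all harmonics is
  absorbed into the constant \<open>sq_norm sphere_measure f / 2\<close>.\<close>

lemma l1_objective_eq:
  assumes "lam > 0" and f: "square_integrable sphere_measure f" and l1: "array_l1_norm \<alpha> < \<infinity>"
  obtains E where "E \<ge> 0" "l1_objective lam f \<alpha> = ennreal E"
    "(\<lambda>l. \<Sum>m\<in>{- int l..int l}. lam * cmod (\<alpha> l m) + (cmod (sph_coeff f l m - \<alpha> l m))\<^sup>2 / 2
        - (cmod (sph_coeff f l m))\<^sup>2 / 2) sums (E - sq_norm sphere_measure f / 2)"
proof -
  let ?S = "\<lambda>L x. \<Sum>l\<le>L. \<Sum>m\<in>{- int l..int l}. \<alpha> l m * sph_harm l m x"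
  define Q where "Q = sq_norm sphere_measure (\<lambda>x. f x - L2_sum \<alpha> x)"
  define A where "A l = (\<Sum>m\<in>{- int l..int l}. cmod (\<alpha> l m))" for l
  have A_nonneg: "A l \<ge> 0" for l by (auto simp: A_def intro: sum_nonneg)
  have S: "square_integrable sphere_measure (L2_sum \<alpha>)"
    and lim: "(\<lambda>L. sq_norm sphere_measure (\<lambda>x. L2_sum \<alpha> x - ?S L x)) \<longlonglongrightarrow> 0"
    using L2_sums_L2_sum[OF l1] by (auto simp: L2_sums_iff)
  have d: "square_integrable sphere_measure (\<lambda>x. f x - L2_sum \<alpha> x)"
    by (intro square_integrable_diff f S)
  \<comment> \<open>The residuals \<open>f - ?S L\<close> converge in mean square to
    \<open>f - L2_sum \<alpha>\<close>, because their difference is the remainder of the series for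
    \<open>L2_sum \<alpha>\<close>.\<close>
  have "(\<lambda>L. sq_norm sphere_measure (\<lambda>x. f x - ?S L x)) \<longlonglongrightarrow> Q"
    unfolding Q_def
    by (rule tendsto_sq_norm[OF d])
       (use lim in \<open>auto intro!: square_integrable_diff f square_integrable_harmonic_sum\<close>)
  then have "(\<lambda>L. sq_norm sphere_measure f + (\<Sum>l\<le>L. \<Sum>m\<in>{- int l..int l}.
        (cmod (sph_coeff f l m - \<alpha> l m))\<^sup>2 - (cmod (sph_coeff f l m))\<^sup>2)) \<longlonglongrightarrow> Q"
    by (simp add: sq_norm_diff_harmonic_sum f)
  from tendsto_diff[OF this tendsto_const[of "sq_norm sphere_measure f"]]
  have quad: "(\<lambda>l. \<Sum>m\<in>{- int l..int l}. (cmod (sph_coeff f l m - \<alpha> l m))\<^sup>2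
        - (cmod (sph_coeff f l m))\<^sup>2) sums (Q - sq_norm sphere_measure f)"
    by (simp add: sums_def_le)
  have A_eq: "array_l1_norm \<alpha> = (\<Sum>l. ennreal (A l))"
    unfolding array_l1_norm_def A_def by (intro suminf_cong) (simp add: sum_ennreal)
  then have A: "summable A"
    using l1 A_nonneg by (intro summable_suminf_not_top) auto
  define E where "E = lam * suminf A + Q / 2"
  have "(\<lambda>l. lam * A l + (\<Sum>m\<in>{- int l..int l}. (cmod (sph_coeff f l m - \<alpha> l m))\<^sup>2
        - (cmod (sph_coeff f l m))\<^sup>2) / 2) sums (lam * suminf A + (Q - sq_norm sphere_measure f) / 2)"
    by (intro sums_add sums_mult summable_sums A sums_divide quad)
  also have "lam * suminf A + (Q - sq_norm sphere_measure f) / 2 = E - sq_norm sphere_measure f / 2"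
    by (simp add: E_def field_simps)
  also have "(\<lambda>l. lam * A l + (\<Sum>m\<in>{- int l..int l}. (cmod (sph_coeff f l m - \<alpha> l m))\<^sup>2
        - (cmod (sph_coeff f l m))\<^sup>2) / 2) = (\<lambda>l. \<Sum>m\<in>{- int l..int l}. lam * cmod (\<alpha> l m)
        + (cmod (sph_coeff f l m - \<alpha> l m))\<^sup>2 / 2 - (cmod (sph_coeff f l m))\<^sup>2 / 2)"
    by (simp add: A_def sum_distrib_left sum_divide_distrib diff_divide_distrib add_diff_eq
        flip: sum.distrib)
  finally have "(\<lambda>l. \<Sum>m\<in>{- int l..int l}. lam * cmod (\<alpha> l m) + (cmod (sph_coeff f l m - \<alpha> l m))\<^sup>2 / 2
        - (cmod (sph_coeff f l m))\<^sup>2 / 2) sums (E - sq_norm sphere_measure f / 2)" .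
  moreover have "l1_objective lam f \<alpha> = ennreal E"
    unfolding l1_objective_def L2_norm_S2_eq[OF d] Q_def[symmetric] A_eq E_def
    using A A_nonneg \<open>lam > 0\<close>
    by (simp add: suminf_ennreal2 ennreal_power Q_def ennreal_plus suminf_nonneg ennreal_mult
          divide_ennreal flip: ennreal_numeral)
  moreover have "E \<ge> 0"
    using A A_nonneg \<open>lam > 0\<close> by (simp add: E_def Q_def suminf_nonneg)
  ultimately show ?thesis using that by blast
qed

text \<open>The total energy in degree \<open>l\<close> tends to zero by Bessel, so from some degree
  on it lies below \<open>lam\<^sup>2\<close>, and so does every single squared coefficient. The
  thresholded array therefore has finite support.\<close>

lemma soft_array_eventually_zero:
  assumes "lam > 0" "square_integrable sphere_measure f"
  obtains L where "\<And>l m. l \<ge> L \<Longrightarrow> soft_array lam (sph_coeff f) l m = 0"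
proof -
  have "(\<lambda>l. \<Sum>m\<in>{- int l..int l}. (cmod (sph_coeff f l m))\<^sup>2) \<longlonglongrightarrow> 0"
    using bessel[OF assms(2)] by (rule summable_LIMSEQ_zero)
  then have "\<forall>\<^sub>F l in sequentially. (\<Sum>m\<in>{- int l..int l}. (cmod (sph_coeff f l m))\<^sup>2) < lam\<^sup>2"
    by (rule order_tendstoD) (use assms in auto)
  then obtain L where L: "\<And>l. l \<ge> L \<Longrightarrow> (\<Sum>m\<in>{- int l..int l}. (cmod (sph_coeff f l m))\<^sup>2) < lam\<^sup>2"
    by (auto simp: eventually_sequentially)
  show ?thesis
  proof (rule that)
    fix l m assume "l \<ge> L"
    show "soft_array lam (sph_coeff f) l m = 0"
    proof (cases "\<bar>m\<bar> \<le> int l")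
      case True
      then have "(cmod (sph_coeff f l m))\<^sup>2 \<le> (\<Sum>m\<in>{- int l..int l}. (cmod (sph_coeff f l m))\<^sup>2)"
        by (intro member_le_sum) auto
      also have "\<dots> < lam\<^sup>2" using L[OF \<open>l \<ge> L\<close>] .
      finally have "cmod (sph_coeff f l m) < lam"
        using assms(1) by (simp add: power2_less_imp_less)
      then show ?thesis by (simp add: soft_array_def soft_threshold_def)
    qed (simp add: soft_array_def)
  qed
qed

text \<open>Both objectives are series with the same constant, so their difference is a series of
  nonnegative terms, with a positive one wherever the arrays differ. Strictness is essential:
  \<open>arg_min\<close> is a choice and is determined only by uniqueness of the minimizer.\<close>

lemma reg_coeff_eq_soft_array:
  assumes "lam > 0" and f: "square_integrable sphere_measure f"
  shows "reg_coeff lam f = soft_array lam (sph_coeff f)"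
proof -
  define s where "s = soft_array lam (sph_coeff f)"
  let ?\<phi> = "\<lambda>\<alpha> l m. lam * cmod (\<alpha> l m) + (cmod (sph_coeff f l m - \<alpha> l m))\<^sup>2 / 2
        - (cmod (sph_coeff f l m))\<^sup>2 / 2"
  have harm: "harmonic_array s"
    by (simp add: harmonic_array_def s_def soft_array_def)
  obtain L where L: "\<And>l m. l \<ge> L \<Longrightarrow> s l m = 0"
    using soft_array_eventually_zero[OF assms] unfolding s_def by blast
  have "array_l1_norm s = (\<Sum>l<L. \<Sum>m\<in>{- int l..int l}. ennreal (cmod (s l m)))"
    unfolding array_l1_norm_def by (rule suminf_finite) (auto simp: L)
  also have "\<dots> < \<infinity>" by simp
  finally have s1: "array_l1_norm s < \<infinity>" .
  obtain Es where Es: "Es \<ge> 0" "l1_objective lam f s = ennreal Es"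
    "(\<lambda>l. \<Sum>m\<in>{- int l..int l}. ?\<phi> s l m) sums (Es - sq_norm sphere_measure f / 2)"
    by (rule l1_objective_eq[OF assms s1])
  have strict: "l1_objective lam f s < l1_objective lam f \<alpha>"
    if \<alpha>: "harmonic_array \<alpha>" "\<alpha> \<noteq> s" for \<alpha>
  proof (cases "array_l1_norm \<alpha> < \<infinity>")
    case False
    then have "l1_objective lam f \<alpha> = \<infinity>"
      using assms by (simp add: l1_objective_def ennreal_mult_top flip: less_top)
    then show ?thesis using Es by simp
  next
    case True
    obtain E where E: "E \<ge> 0" "l1_objective lam f \<alpha> = ennreal E"
      "(\<lambda>l. \<Sum>m\<in>{- int l..int l}. ?\<phi> \<alpha> l m) sums (E - sq_norm sphere_measure f / 2)"
      by (rule l1_objective_eq[OF assms True])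
    define D where "D l = (\<Sum>m\<in>{- int l..int l}. ?\<phi> \<alpha> l m - ?\<phi> s l m)" for l
    have D: "D sums (E - Es)"
      using sums_diff[OF E(3) Es(3)] unfolding D_def[abs_def] sum_subtractf[symmetric] by simp
    have less: "?\<phi> s l m < ?\<phi> \<alpha> l m" if "\<alpha> l m \<noteq> s l m" "\<bar>m\<bar> \<le> int l" for l m
      using soft_threshold_minimizes[OF \<open>lam > 0\<close>, of "\<alpha> l m" "sph_coeff f l m"] that
      by (simp add: s_def soft_array_def)
    then have le: "?\<phi> s l m \<le> ?\<phi> \<alpha> l m" if "\<bar>m\<bar> \<le> int l" for l m
      using that by (cases "\<alpha> l m = s l m") (auto intro: less_imp_le)
    obtain l m where lm: "\<alpha> l m \<noteq> s l m" using \<alpha>(2) by (auto simp: fun_eq_iff)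
    then have m: "\<bar>m\<bar> \<le> int l" using \<alpha>(1) harm by (metis harmonic_array_def not_le)
    have "D l' \<ge> 0" for l' unfolding D_def
      by (intro sum_nonneg) (subst diff_ge_0_iff_ge, rule le, simp add: abs_le_iff)
    moreover have "D l > 0" unfolding D_def
    proof (rule sum_pos2[of _ m])
      show "?\<phi> \<alpha> l m - ?\<phi> s l m > 0"
        using less[OF lm m] by (subst diff_gt_0_iff_gt)
      show "?\<phi> \<alpha> l k - ?\<phi> s l k \<ge> 0" if "k \<in> {- int l..int l}" for k
        by (subst diff_ge_0_iff_ge, rule le) (use that in \<open>simp add: abs_le_iff\<close>)
    qed (use m in \<open>auto simp: abs_le_iff\<close>)
    ultimately have "suminf D > 0"
      by (intro suminf_pos2[of D l] sums_summable[OF D]) auto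
    then have "Es < E" using sums_unique[OF D] by simp
    then show ?thesis using E Es by (simp add: ennreal_less_iff)
  qed
  have "is_arg_min (l1_objective lam f) harmonic_array \<alpha> \<longleftrightarrow> \<alpha> = s" for \<alpha>
  proof
    show "\<alpha> = s" if "is_arg_min (l1_objective lam f) harmonic_array \<alpha>"
      using that harm strict[of \<alpha>] unfolding is_arg_min_def by blast
    show "is_arg_min (l1_objective lam f) harmonic_array \<alpha>" if "\<alpha> = s"
      using that harm strict unfolding is_arg_min_def by (metis less_asym)
  qed
  then show ?thesis
    by (simp add: reg_coeff_def arg_min_def s_def)
qed

text \<open>The choice made here is unspecified but the same for all such \<open>f\<close>; this
  constancy keeps the regularized field measurable on the exceptional realizations.\<close>

lemma reg_coeff_not_square_integrable:
  assumes "lam > 0" "f \<in> borel_measurable sphere_measure" "\<not> square_integrable sphere_measure f"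
  shows "reg_coeff lam f = arg_min (\<lambda>_. \<infinity> :: ennreal) harmonic_array"
proof -
  have "l1_objective lam f = (\<lambda>_. \<infinity>)"
    using l1_objective_eq_top[OF assms] by (rule ext)
  then show ?thesis by (simp only: reg_coeff_def)
qed

end

section \<open>Independent families\<close>

context prob_space
begin

text \<open>Fubini: the joint law of an independent pair is the product law, and every section of
  \<open>S\<close> at a fixed value of \<open>V\<close> is null for the law of
  \<open>U\<close>.\<close>

lemma AE_indep_var_notin:
  assumes indep: "indep_var N1 U N2 V" and S: "S \<in> sets (N1 \<Otimes>\<^sub>M N2)"
    and slice: "\<And>v. v \<in> space N2 \<Longrightarrow> prob {\<omega> \<in> space M. (U \<omega>, v) \<in> S} = 0"
  shows "AE \<omega> in M. (U \<omega>, V \<omega>) \<notin> S"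
proof -
  have U [measurable]: "U \<in> measurable M N1" and V [measurable]: "V \<in> measurable M N2"
    and eq: "distr M N1 U \<Otimes>\<^sub>M distr M N2 V = distr M (N1 \<Otimes>\<^sub>M N2) (\<lambda>\<omega>. (U \<omega>, V \<omega>))"
    using indep by (auto simp: indep_var_distribution_eq)
  interpret U: prob_space "distr M N1 U" by (rule prob_space_distr) fact
  interpret V: prob_space "distr M N2 V" by (rule prob_space_distr) fact
  interpret pair_sigma_finite "distr M N1 U" "distr M N2 V" ..
  have "emeasure M ((\<lambda>\<omega>. (U \<omega>, V \<omega>)) -` S \<inter> space M)
      = emeasure (distr M N1 U \<Otimes>\<^sub>M distr M N2 V) S"
    unfolding eq by (rule emeasure_distr[symmetric]) (use S in auto)
  also have "\<dots> = (\<integral>\<^sup>+v. emeasure (distr M N1 U) ((\<lambda>u. (u, v)) -` S) \<partial>distr M N2 V)"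
    by (rule emeasure_pair_measure_alt2) (use S eq in \<open>simp add: sets_distr\<close>)
  also have "\<dots> = (\<integral>\<^sup>+v. 0 \<partial>distr M N2 V)"
  proof (rule nn_integral_cong)
    fix v assume v: "v \<in> space (distr M N2 V)"
    have "emeasure (distr M N1 U) ((\<lambda>u. (u, v)) -` S) = emeasure M (U -` ((\<lambda>u. (u, v)) -` S) \<inter> space M)"
      by (rule emeasure_distr) (use S in \<open>auto intro: sets_Pair2\<close>)
    also have "U -` ((\<lambda>u. (u, v)) -` S) \<inter> space M = {\<omega> \<in> space M. (U \<omega>, v) \<in> S}"
      by auto
    finally show "emeasure (distr M N1 U) ((\<lambda>u. (u, v)) -` S) = 0"
      using slice[of v] v by (simp add: emeasure_eq_measure)
  qed
  finally show ?thesis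
    using S by (intro AE_I[of _ _ "(\<lambda>\<omega>. (U \<omega>, V \<omega>)) -` S \<inter> space M"]) auto
qed

text \<open>Positivity of an infinite product of probabilities: the finitely many factors in the
  head are positive, the tail product is at least \<open>1 - c\<close> by the Weierstrass
  inequality, and continuity from above passes to the intersection.\<close>

lemma prob_indep_vars_Ball_pos:
  assumes indep: "indep_vars (\<lambda>_. N) X I"
    and F: "\<And>n. finite (F n)" "incseq F" "(\<Union>n. F n) = I"
    and B: "\<And>i. i \<in> I \<Longrightarrow> B i \<in> sets N"
    and pos: "\<And>i. i \<in> I \<Longrightarrow> prob {\<omega> \<in> space M. X i \<omega> \<in> B i} > 0"
    and tail: "\<And>n. (\<Sum>i\<in>F n - F n\<^sub>0. 1 - prob {\<omega> \<in> space M. X i \<omega> \<in> B i}) \<le> c" "c < 1"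
  shows "prob {\<omega> \<in> space M. \<forall>i\<in>I. X i \<omega> \<in> B i} > 0"
proof -
  define p where "p i = prob {\<omega> \<in> space M. X i \<omega> \<in> B i}" for i
  have FI: "F n \<subseteq> I" for n using F by auto
  define E where "E n = {\<omega> \<in> space M. \<forall>i\<in>F n. X i \<omega> \<in> B i}" for n
  have X: "X i \<in> measurable M N" if "i \<in> I" for i
    using indep that by (auto simp: indep_vars_def)
  have ev: "{\<omega> \<in> space M. X i \<omega> \<in> B i} \<in> events" if "i \<in> I" for i
    using measurable_sets[OF X[OF that] B[OF that]] by (simp add: vimage_def Int_def conj_commute)
  have E_ev: "E n \<in> events" for n
    unfolding E_def by (intro sets.sets_Collect_finite_All F ev) (use FI in auto)
  have pE: "prob (E n) = (\<Prod>i\<in>F n. p i)" for n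
  proof (cases "F n = {}")
    case True
    then show ?thesis by (simp add: E_def prob_space)
  next
    case False
    have "E n = (\<Inter>i\<in>F n. X i -` B i \<inter> space M)"
      using False by (auto simp: E_def)
    also have "prob \<dots> = (\<Prod>i\<in>F n. prob (X i -` B i \<inter> space M))"
      using FI by (intro indep_varsD[OF indep] False F B) auto
    also have "\<dots> = (\<Prod>i\<in>F n. p i)"
      unfolding p_def by (intro prod.cong refl arg_cong[where f = prob]) auto
    finally show ?thesis .
  qed
  \<comment> \<open>A lower bound for \<open>prob (E n)\<close> that is uniform in \<open>n\<close>
    beyond the head, hence inherited by the limit.\<close>
  define q where "q = (\<Prod>i\<in>F n\<^sub>0. p i) * (1 - c)"
  have "q > 0"
    unfolding q_def using pos FI[of n\<^sub>0] tail(2) by (intro mult_pos_pos prod_pos) (auto simp: p_def)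
  have "q \<le> prob (E n)" if "n \<ge> n\<^sub>0" for n
  proof -
    have sub: "F n\<^sub>0 \<subseteq> F n" using F(2) that by (simp add: incseq_def)
    have "1 - c \<le> 1 - (\<Sum>i\<in>F n - F n\<^sub>0. 1 - p i)"
      using tail(1)[of n] by (simp add: p_def)
    also have "\<dots> \<le> (\<Prod>i\<in>F n - F n\<^sub>0. 1 - (1 - p i))"
      by (rule Weierstrass_prod_ineq) (auto simp: p_def)
    finally have "1 - c \<le> (\<Prod>i\<in>F n - F n\<^sub>0. p i)" by simp
    then have "q \<le> (\<Prod>i\<in>F n\<^sub>0. p i) * (\<Prod>i\<in>F n - F n\<^sub>0. p i)"
      unfolding q_def by (intro mult_left_mono) (auto intro: prod_nonneg simp: p_def)
    also have "\<dots> = prob (E n)"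
      unfolding pE using prod.subset_diff[OF sub F(1), of p] by (simp add: mult.commute)
    finally show ?thesis .
  qed
  moreover have "(\<lambda>n. prob (E n)) \<longlonglongrightarrow> prob (\<Inter>n. E n)"
  proof (rule finite_Lim_measure_decseq)
    show "range E \<subseteq> events" using E_ev by auto
    show "decseq E"
      unfolding decseq_def E_def using F(2) by (auto simp: incseq_def)
  qed
  ultimately have "q \<le> prob (\<Inter>n. E n)"
    by (intro LIMSEQ_le_const) auto
  also have "(\<Inter>n. E n) = {\<omega> \<in> space M. \<forall>i\<in>I. X i \<omega> \<in> B i}"
    using F(3) by (auto simp: E_def)
  finally show ?thesis using \<open>q > 0\<close> by simp
qed

lemma prob_normal_eq_0:
  assumes "distributed M lborel Z (normal_density \<mu> \<sigma>)"
  shows "prob {\<omega> \<in> space M. Z \<omega> = c} = 0"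
proof -
  have "emeasure M (Z -` {c} \<inter> space M)
      = (\<integral>\<^sup>+x. ennreal (normal_density \<mu> \<sigma> x) * indicator {c} x \<partial>lborel)"
    by (rule distributed_emeasure[OF assms]) auto
  also have "\<dots> = (\<integral>\<^sup>+x. 0 \<partial>(lborel :: real measure))"
  proof (rule nn_integral_cong_AE)
    show "AE x in lborel. ennreal (normal_density \<mu> \<sigma> x) * indicator {c} x = 0"
      using AE_lborel_singleton[of c] by eventually_elim simp
  qed
  finally have "prob (Z -` {c} \<inter> space M) = 0"
    by (simp add: emeasure_eq_measure)
  moreover have "Z -` {c} \<inter> space M = {\<omega> \<in> space M. Z \<omega> = c}" by auto
  ultimately show ?thesis by simp
qed

lemma prob_normal_pos:
  assumes "distributed M lborel Z (normal_density \<mu> \<sigma>)" "\<sigma> > 0" "a < b"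
  shows "prob {\<omega> \<in> space M. Z \<omega> \<in> {a<..<b}} > 0"
proof (rule ccontr)
  assume "\<not> ?thesis"
  then have "prob {\<omega> \<in> space M. Z \<omega> \<in> {a<..<b}} = 0"
    by (simp add: zero_less_measure_iff)
  moreover have "{\<omega> \<in> space M. Z \<omega> \<in> {a<..<b}} = Z -` {a<..<b} \<inter> space M" by auto
  ultimately have "emeasure M (Z -` {a<..<b} \<inter> space M) = 0"
    by (simp add: emeasure_eq_measure)
  then have "(\<integral>\<^sup>+x. ennreal (normal_density \<mu> \<sigma> x) * indicator {a<..<b} x \<partial>lborel) = 0"
    by (subst (asm) distributed_emeasure[OF assms(1)]) auto
  then have "AE x in lborel. ennreal (normal_density \<mu> \<sigma> x) * indicator {a<..<b} x = 0"
    by (subst (asm) nn_integral_0_iff_AE) auto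
  then have "AE x in lborel. x \<notin> {a<..<b}"
  proof eventually_elim
    case (elim x)
    then show ?case
      using normal_density_pos[OF assms(2), of \<mu> x] by (auto simp: indicator_def split: if_splits)
  qed
  then have "emeasure lborel {a<..<b} = 0"
    by (rule AE_iff_measurable[THEN iffD1, rotated 2]) auto
  then show False using assms(3) by simp
qed

lemma prob_normal_ge_le:
  assumes D: "distributed M lborel Z (normal_density 0 \<sigma>)" and "\<sigma> > 0" "a > 0"
  shows "prob {\<omega> \<in> space M. \<bar>Z \<omega>\<bar> \<ge> a} \<le> \<sigma>\<^sup>2 / a\<^sup>2"
proof -
  have "integrable M (\<lambda>\<omega>. (Z \<omega>)\<^sup>2)"
    using integrable_normal_moment[OF assms(2), of 0 2]
    by (subst (asm) distributed_integrable[OF D]) auto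
  moreover have "Z \<in> borel_measurable M"
    using distributed_measurable[OF D] by simp
  ultimately show ?thesis
    using Chebyshev_inequality[of Z a] assms(3) normal_distributed_expectation[OF assms(2) D]
      normal_distributed_variance[OF assms(2) D]
    by simp
qed

text \<open>If \<open>u\<close> is nonzero, fixing the value of \<open>Y\<close> leaves at most one
  value for \<open>X\<close>, which a normal variable attains with probability zero; independence
  then permits Fubini. The complex numbers \<open>u\<close> and \<open>v\<close> may be real
  multiples of each other, so the level set can be a whole line.\<close>

lemma prob_affine_normal_eq_0:
  fixes u v w :: complex
  assumes indep: "indep_var borel X borel Y"
    and X: "distributed M lborel X (normal_density \<mu> \<sigma>)"
    and Y: "distributed M lborel Y (normal_density \<nu> \<tau>)"
    and "u \<noteq> 0 \<or> v \<noteq> 0"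
  shows "prob {\<omega> \<in> space M. u * of_real (X \<omega>) + v * of_real (Y \<omega>) = w} = 0"
proof (cases "u = 0")
  case True
  then have "{\<omega> \<in> space M. u * of_real (X \<omega>) + v * of_real (Y \<omega>) = w} \<subseteq> {\<omega> \<in> space M. Y \<omega> = Re (w / v)}"
    using assms(4) by (auto simp: Re_divide_of_real)
  moreover have "{\<omega> \<in> space M. Y \<omega> = Re (w / v)} \<in> events"
    using distributed_measurable[OF Y] by measurable
  ultimately have "prob {\<omega> \<in> space M. u * of_real (X \<omega>) + v * of_real (Y \<omega>) = w}
      \<le> prob {\<omega> \<in> space M. Y \<omega> = Re (w / v)}"
    by (rule finite_measure_mono)
  then show ?thesis
    by (simp only: prob_normal_eq_0[OF Y] measure_le_0_iff)
next
  case False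
  define S where "S = {p :: real \<times> real. u * of_real (fst p) + v * of_real (snd p) = w}"
  have "closed S"
    unfolding S_def by (intro closed_Collect_eq continuous_intros)
  then have S: "S \<in> sets (borel \<Otimes>\<^sub>M borel)"
    unfolding borel_prod by (rule borel_closed)
  have [measurable]: "X \<in> borel_measurable M"
    using distributed_measurable[OF X] by simp
  have "prob {\<omega> \<in> space M. (X \<omega>, y) \<in> S} = 0" for y
  proof -
    have "{\<omega> \<in> space M. (X \<omega>, y) \<in> S} \<subseteq> {\<omega> \<in> space M. X \<omega> = Re ((w - v * of_real y) / u)}"
    proof clarsimp
      fix \<omega> assume "(X \<omega>, y) \<in> S"
      then have "of_real (X \<omega>) = (w - v * of_real y) / u"
        using False by (simp add: S_def field_simps)
      then show "X \<omega> = Re ((w - v * of_real y) / u)"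
        by (metis Re_complex_of_real)
    qed
    moreover have "{\<omega> \<in> space M. X \<omega> = Re ((w - v * of_real y) / u)} \<in> events"
      by measurable
    ultimately have "prob {\<omega> \<in> space M. (X \<omega>, y) \<in> S}
        \<le> prob {\<omega> \<in> space M. X \<omega> = Re ((w - v * of_real y) / u)}"
      by (rule finite_measure_mono)
    then show ?thesis
      by (simp only: prob_normal_eq_0[OF X] measure_le_0_iff)
  qed
  then have "AE \<omega> in M. (X \<omega>, Y \<omega>) \<notin> S"
    by (intro AE_indep_var_notin[OF indep S])
  then show ?thesis
    using distributed_measurable[OF X] distributed_measurable[OF Y]
    by (subst prob_eq_0) (auto simp: S_def)
qed

text \<open>Splitting off one term of the series leaves a remainder independent of it, so a
  continuously distributed term cannot balance the remainder.\<close>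

lemma AE_indep_series_not_sums_zero:
  fixes X :: "nat \<times> nat \<Rightarrow> 'a \<Rightarrow> complex" and H :: "nat \<times> nat \<Rightarrow> complex \<Rightarrow> complex"
  assumes indep: "indep_vars (\<lambda>_. borel) X {(l, k). k \<le> l}"
    and H [measurable]: "\<And>i. H i \<in> borel_measurable borel"
    and "k\<^sub>0 \<le> l\<^sub>0" and E [measurable]: "E \<in> sets borel"
    and slice: "\<And>w. prob {\<omega> \<in> space M. X (l\<^sub>0, k\<^sub>0) \<omega> \<in> E \<and> H (l\<^sub>0, k\<^sub>0) (X (l\<^sub>0, k\<^sub>0) \<omega>) = w} = 0"
  shows "AE \<omega> in M. X (l\<^sub>0, k\<^sub>0) \<omega> \<in> E \<longrightarrow> \<not> (\<lambda>l. \<Sum>k\<le>l. H (l, k) (X (l, k) \<omega>)) sums 0"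
proof -
  define I :: "(nat \<times> nat) set" where "I = {(l, k). k \<le> l}"
  define J where "J = I - {(l\<^sub>0, k\<^sub>0)}"
  \<comment> \<open>The remainder of the series as a function of the other coordinates only: the
    singled-out term is replaced by zero, so \<open>W\<close> never reads the coordinate outside
    \<open>J\<close>.\<close>
  define W :: "(nat \<times> nat \<Rightarrow> complex) \<Rightarrow> complex" where
    "W g = (\<Sum>l. \<Sum>k\<le>l. if (l, k) = (l\<^sub>0, k\<^sub>0) then 0 else H (l, k) (g (l, k)))" for g
  have W: "W \<in> borel_measurable (PiM J (\<lambda>_. borel))"
    unfolding W_def
  proof (intro borel_measurable_suminf borel_measurable_sum)
    fix l k :: nat assume "k \<in> {..l}"
    show "(\<lambda>g. if (l, k) = (l\<^sub>0, k\<^sub>0) then 0 else H (l, k) (g (l, k))) \<in> borel_measurable (PiM J (\<lambda>_. borel))"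
    proof (cases "(l, k) = (l\<^sub>0, k\<^sub>0)")
      case False
      then have "(\<lambda>g. g (l, k)) \<in> borel_measurable (PiM J (\<lambda>_. borel))"
        using \<open>k \<in> {..l}\<close> by (intro measurable_component_singleton) (auto simp: J_def I_def)
      then show ?thesis
        unfolding if_not_P[OF False] by measurable
    qed simp
  qed
  define V where "V \<omega> = W (\<lambda>i\<in>J. X i \<omega>)" for \<omega>
  have "indep_var (PiM {(l\<^sub>0, k\<^sub>0)} (\<lambda>_. borel)) (\<lambda>\<omega>. \<lambda>i\<in>{(l\<^sub>0, k\<^sub>0)}. X i \<omega>)
      (PiM J (\<lambda>_. borel)) (\<lambda>\<omega>. \<lambda>i\<in>J. X i \<omega>)"
    using \<open>k\<^sub>0 \<le> l\<^sub>0\<close> by (intro indep_var_restrict[OF indep]) (auto simp: J_def I_def)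
  then have "indep_var borel ((\<lambda>g. g (l\<^sub>0, k\<^sub>0)) \<circ> (\<lambda>\<omega>. \<lambda>i\<in>{(l\<^sub>0, k\<^sub>0)}. X i \<omega>))
      borel (W \<circ> (\<lambda>\<omega>. \<lambda>i\<in>J. X i \<omega>))"
    by (rule indep_var_compose) (auto intro: W measurable_component_singleton)
  then have UV: "indep_var borel (X (l\<^sub>0, k\<^sub>0)) borel V"
    by (simp add: comp_def V_def[abs_def])
  \<comment> \<open>The pairs in which the singled-out term exactly cancels the remainder; its
    section at \<open>v\<close> is the event of \<open>slice\<close> with
    \<open>w = - v\<close>.\<close>
  define S where "S = {p :: complex \<times> complex. fst p \<in> E \<and> H (l\<^sub>0, k\<^sub>0) (fst p) = - snd p}"
  have S: "S \<in> sets (borel \<Otimes>\<^sub>M borel)"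
  proof -
    have "{p \<in> space (borel \<Otimes>\<^sub>M borel). fst p \<in> E \<and> H (l\<^sub>0, k\<^sub>0) (fst p) = - snd p}
        \<in> sets (borel \<Otimes>\<^sub>M borel)"
      by measurable
    then show ?thesis
      by (simp add: S_def space_pair_measure)
  qed
  have "AE \<omega> in M. (X (l\<^sub>0, k\<^sub>0) \<omega>, V \<omega>) \<notin> S"
    by (rule AE_indep_var_notin[OF UV S]) (simp add: S_def slice)
  then show ?thesis
  proof eventually_elim
    case (elim \<omega>)
    show ?case
    proof (intro impI notI)
      assume "X (l\<^sub>0, k\<^sub>0) \<omega> \<in> E" and s: "(\<lambda>l. \<Sum>k\<le>l. H (l, k) (X (l, k) \<omega>)) sums 0"
      have "(\<lambda>l. if l = l\<^sub>0 then H (l\<^sub>0, k\<^sub>0) (X (l\<^sub>0, k\<^sub>0) \<omega>) else 0) sums H (l\<^sub>0, k\<^sub>0) (X (l\<^sub>0, k\<^sub>0) \<omega>)"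
        by (rule sums_single)
      from sums_diff[OF s this]
      have "(\<lambda>l. (\<Sum>k\<le>l. H (l, k) (X (l, k) \<omega>)) - (if l = l\<^sub>0 then H (l\<^sub>0, k\<^sub>0) (X (l\<^sub>0, k\<^sub>0) \<omega>) else 0))
          sums (- H (l\<^sub>0, k\<^sub>0) (X (l\<^sub>0, k\<^sub>0) \<omega>))"
        by simp
      moreover have "(\<Sum>k\<le>l. H (l, k) (X (l, k) \<omega>)) - (if l = l\<^sub>0 then H (l\<^sub>0, k\<^sub>0) (X (l\<^sub>0, k\<^sub>0) \<omega>) else 0)
          = (\<Sum>k\<le>l. if (l, k) = (l\<^sub>0, k\<^sub>0) then 0 else H (l, k) ((\<lambda>i\<in>J. X i \<omega>) (l, k)))" for l
      proof -
        have "(\<Sum>k\<le>l. H (l, k) (X (l, k) \<omega>))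
            = (\<Sum>k\<le>l. (if (l, k) = (l\<^sub>0, k\<^sub>0) then 0 else H (l, k) ((\<lambda>i\<in>J. X i \<omega>) (l, k)))
                + (if k = k\<^sub>0 then if l = l\<^sub>0 then H (l\<^sub>0, k\<^sub>0) (X (l\<^sub>0, k\<^sub>0) \<omega>) else 0 else 0))"
          by (intro sum.cong) (auto simp: J_def I_def)
        then show ?thesis
          using \<open>k\<^sub>0 \<le> l\<^sub>0\<close> by (simp add: sum.distrib)
      qed
      ultimately have "V \<omega> = - H (l\<^sub>0, k\<^sub>0) (X (l\<^sub>0, k\<^sub>0) \<omega>)"
        unfolding V_def W_def by (simp add: sums_iff)
      then show False
        using elim \<open>X (l\<^sub>0, k\<^sub>0) \<omega> \<in> E\<close> by (simp add: S_def)
    qed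
  qed
qed

end

section \<open>Orthonormality of the spherical harmonics\<close>

text \<open>The joint contribution of the orders \<open>k\<close> and \<open>-k\<close> to a harmonic sum, as a function of
  the coefficient of order \<open>k\<close>.\<close>

definition paired_term :: "(nat \<Rightarrow> int \<Rightarrow> complex) \<Rightarrow> nat \<Rightarrow> nat \<Rightarrow> complex \<Rightarrow> complex" where
  "paired_term y l k z =
     z * y l (int k) + (if k = 0 then 0 else (-1) ^ k * cnj z * y l (- int k))"

lemma paired_term_zero [simp]: "paired_term y l k 0 = 0"
  by (simp add: paired_term_def)

lemma borel_measurable_paired_term [measurable]: "paired_term y l k \<in> borel_measurable borel"
  unfolding paired_term_def[abs_def] by measurable

lemma sum_symmetric_int:
  fixes g :: "int \<Rightarrow> 'b::comm_monoid_add"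
  shows "(\<Sum>m\<in>{- int l..int l}. g m) = (\<Sum>k\<le>l. g (int k) + (if k = 0 then 0 else g (- int k)))"
proof (induction l)
  case (Suc l)
  have "{- int (Suc l)..int (Suc l)} = insert (int (Suc l)) (insert (- int (Suc l)) {- int l..int l})"
    by auto
  then show ?case
    using Suc by (simp add: add_ac)
qed simp

text \<open>The hypothesis is the symmetry of the coefficients of a real field; under it a sum over
  all orders becomes a sum over the independent coefficients.\<close>

lemma sum_eq_sum_paired_term:
  assumes "\<And>k. b (- int k) = (-1) ^ k * cnj (b (int k))"
  shows "(\<Sum>m\<in>{- int l..int l}. b m * y l m) = (\<Sum>k\<le>l. paired_term y l k (b (int k)))"
  unfolding sum_symmetric_int paired_term_def by (intro sum.cong) (auto simp: assms)

lemma harm_coeff_minus: "harm_coeff T l (- int k) \<omega> = (-1) ^ k * cnj (harm_coeff T l (int k) \<omega>)"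
proof -
  have "harm_coeff T l (- int k) \<omega>
      = (\<integral>x. (-1) ^ k * cnj (of_real (T \<omega> x) * cnj (sph_harm l (int k) x)) \<partial>sphere_measure)"
    by (simp add: harm_coeff_def sph_harm_minus mult_ac)
  then show ?thesis
    by (simp only: integral_mult_right_zero Bochner_Integration.integral_cnj harm_coeff_def)
qed

lemma sph_coeff_sph_harm_minus:
  "sph_coeff (sph_harm l (- m)) l' (- m')
    = (-1) ^ nat \<bar>m\<bar> * (-1) ^ nat \<bar>m'\<bar> * cnj (sph_coeff (sph_harm l m) l' m')"
proof -
  have "sph_coeff (sph_harm l (- m)) l' (- m') = (\<integral>x. (-1) ^ nat \<bar>m\<bar> * (-1) ^ nat \<bar>m'\<bar> *
      cnj (sph_harm l m x * cnj (sph_harm l' m' x)) \<partial>sphere_measure)"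
    by (simp add: sph_coeff_def sph_harm_minus mult_ac)
  then show ?thesis
    by (simp only: integral_mult_right_zero Bochner_Integration.integral_cnj sph_coeff_def)
qed

locale spectral_field = prob_space M for M :: "'w measure" +
  fixes T :: "'w \<Rightarrow> real^3 \<Rightarrow> real" and C :: "nat \<Rightarrow> real"
  assumes field: "random_field M T"
    and spectrum: "angular_power_spectrum M T C"
    and C_pos: "\<And>l. 0 < C l"
begin

abbreviation coeff :: "nat \<times> nat \<Rightarrow> 'w \<Rightarrow> complex" where
  "coeff i \<omega> \<equiv> harm_coeff T (fst i) (int (snd i)) \<omega>"

abbreviation cfield :: "'w \<Rightarrow> real^3 \<Rightarrow> complex" where
  "cfield \<omega> \<equiv> (\<lambda>x. complex_of_real (T \<omega> x))"

lemma harm_coeff_eq: "harm_coeff T l m \<omega> = sph_coeff (cfield \<omega>) l m"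
  by (simp add: harm_coeff_def sph_coeff_def)

lemma indep_coeff: "indep_vars (\<lambda>_. borel) coeff {(l, k). k \<le> l}"
proof -
  have "(\<lambda>(l, k) \<omega>. harm_coeff T l (int k) \<omega>) = coeff"
    by (simp add: fun_eq_iff)
  then show ?thesis
    using spectrum by (simp add: angular_power_spectrum_def)
qed

lemma coeff_zero_real: "\<omega> \<in> space M \<Longrightarrow> Im (harm_coeff T l 0 \<omega>) = 0"
  using spectrum by (auto simp: angular_power_spectrum_def complex_is_Real_iff)

lemma coeff_zero_distr:
  "distributed M lborel (\<lambda>\<omega>. Re (harm_coeff T l 0 \<omega>)) (normal_density 0 (sqrt (C l)))"
  using spectrum by (simp add: angular_power_spectrum_def)

lemma
  assumes "k \<noteq> 0" "k \<le> l"
  shows coeff_indep: "indep_var borel (\<lambda>\<omega>. Re (coeff (l, k) \<omega>)) borel (\<lambda>\<omega>. Im (coeff (l, k) \<omega>))"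
    and coeff_Re_distr: "distributed M lborel (\<lambda>\<omega>. Re (coeff (l, k) \<omega>)) (normal_density 0 (sqrt (C l / 2)))"
    and coeff_Im_distr: "distributed M lborel (\<lambda>\<omega>. Im (coeff (l, k) \<omega>)) (normal_density 0 (sqrt (C l / 2)))"
  using spectrum assms by (simp_all add: angular_power_spectrum_def)

lemma AE_L2_sums: "AE \<omega> in M. L2_sums (\<lambda>l m. harm_coeff T l m \<omega>) (cfield \<omega>)"
  using spectrum by (simp add: angular_power_spectrum_def)

text \<open>For \<open>k = 0\<close> the coefficient is real, so \<open>v\<close> multiplies zero
  and nondegeneracy must come from \<open>u\<close>; this explains the asymmetric
  assumption.\<close>

lemma prob_coeff_linear_eq_0:
  fixes u v w :: complex
  assumes "k \<le> l" "u \<noteq> 0 \<or> k \<noteq> 0 \<and> v \<noteq> 0"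
  shows "prob {\<omega> \<in> space M. u * of_real (Re (coeff (l, k) \<omega>)) + v * of_real (Im (coeff (l, k) \<omega>)) = w} = 0"
proof (cases "k = 0")
  case True
  have "{\<omega> \<in> space M. u * of_real (Re (coeff (l, k) \<omega>)) + v * of_real (Im (coeff (l, k) \<omega>)) = w}
      \<subseteq> {\<omega> \<in> space M. Re (harm_coeff T l 0 \<omega>) = Re (w / u)}"
    using assms True by (auto simp: coeff_zero_real)
  moreover have "{\<omega> \<in> space M. Re (harm_coeff T l 0 \<omega>) = Re (w / u)} \<in> events"
    using distributed_measurable[OF coeff_zero_distr] by measurable
  ultimately have "prob {\<omega> \<in> space M. u * of_real (Re (coeff (l, k) \<omega>)) + v * of_real (Im (coeff (l, k) \<omega>)) = w}
      \<le> prob {\<omega> \<in> space M. Re (harm_coeff T l 0 \<omega>) = Re (w / u)}"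
    by (rule finite_measure_mono)
  then show ?thesis
    by (simp only: prob_normal_eq_0[OF coeff_zero_distr] measure_le_0_iff)
next
  case False
  with assms show ?thesis
    by (intro prob_affine_normal_eq_0[OF coeff_indep coeff_Re_distr coeff_Im_distr]) auto
qed

text \<open>The spectral representation is paired with one fixed harmonic; mean-square convergence
  allows the inner product to be taken term by term, which brings in the entries of the Gram
  matrix.\<close>

lemma AE_gram_expansion:
  "AE \<omega> in M. (\<lambda>l. \<Sum>m\<in>{- int l..int l}. harm_coeff T l m \<omega> * sph_coeff (sph_harm l m) l' m')
     sums harm_coeff T l' m' \<omega>"
  using AE_L2_sums
proof eventually_elim
  case (elim \<omega>)
  let ?u = "\<lambda>L x. \<Sum>l\<le>L. \<Sum>m\<in>{- int l..int l}. harm_coeff T l m \<omega> * sph_harm l m x"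
  note int = integrable_mult_cnj[OF square_integrable_sph_harm square_integrable_sph_harm]
  have "(\<lambda>L. \<integral>x. ?u L x * cnj (sph_harm l' m' x) \<partial>sphere_measure)
      \<longlonglongrightarrow> (\<integral>x. cfield \<omega> x * cnj (sph_harm l' m' x) \<partial>sphere_measure)"
    using elim
    by (intro tendsto_integral_mult_cnj square_integrable_sph_harm square_integrable_harmonic_sum)
       (auto simp: L2_sums_iff)
  moreover have "(\<integral>x. ?u L x * cnj (sph_harm l' m' x) \<partial>sphere_measure)
      = (\<Sum>l\<le>L. \<Sum>m\<in>{- int l..int l}. harm_coeff T l m \<omega> * sph_coeff (sph_harm l m) l' m')" for L
    unfolding sum_distrib_right mult.assoc sph_coeff_def
    by (subst Bochner_Integration.integral_sum
        | intro Bochner_Integration.integrable_sum integrable_mult_right int sum.cong refl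
        | simp only: integral_mult_right_zero)+
  ultimately show ?case
    by (simp add: sums_def_le harm_coeff_def)
qed

text \<open>Moving the right-hand side of the Gram expansion into its own term gives a series of
  independent terms with sum zero. A term that does not vanish identically would be free of atoms
  and could not be balanced by the rest, so every term vanishes, and its two real-linear
  coefficients determine the Gram entries of orders \<open>k\<close> and \<open>-k\<close>.\<close>

lemma gram_nonneg_order:
  assumes "k \<le> l" "k' \<le> l'"
  shows "sph_coeff (sph_harm l (int k)) l' (int k') = (if (l, k) = (l', k') then 1 else 0)"
    and "k \<noteq> 0 \<Longrightarrow> sph_coeff (sph_harm l (- int k)) l' (int k') = 0"
proof -
  define G where "G l m = sph_coeff (sph_harm l m) l' (int k')" for l m
  define d :: "nat \<times> nat \<Rightarrow> complex" where "d i = (if i = (l', k') then 1 else 0)" for i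
  define H where "H i z = paired_term G (fst i) (snd i) z - d i * z" for i z
  have zero: "AE \<omega> in M. (\<lambda>l. \<Sum>k\<le>l. H (l, k) (coeff (l, k) \<omega>)) sums 0"
    using AE_gram_expansion[of l' "int k'"]
  proof eventually_elim
    case (elim \<omega>)
    then have "(\<lambda>l. \<Sum>k\<le>l. paired_term G l k (coeff (l, k) \<omega>)) sums harm_coeff T l' (int k') \<omega>"
      unfolding G_def[symmetric]
      by (subst (asm) sum_eq_sum_paired_term) (simp_all add: harm_coeff_minus)
    moreover have "(\<lambda>l. if l = l' then harm_coeff T l' (int k') \<omega> else 0) sums harm_coeff T l' (int k') \<omega>"
      by (rule sums_single)
    moreover have "(\<Sum>k\<le>l. d (l, k) * coeff (l, k) \<omega>) = (if l = l' then harm_coeff T l' (int k') \<omega> else 0)" for l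
    proof -
      have "(\<Sum>k\<le>l. d (l, k) * coeff (l, k) \<omega>)
          = (\<Sum>k\<le>l. if k = k' then if l = l' then harm_coeff T l' (int k') \<omega> else 0 else 0)"
        by (intro sum.cong) (auto simp: d_def)
      then show ?thesis using \<open>k' \<le> l'\<close> by simp
    qed
    ultimately show ?case
      unfolding H_def using sums_diff[where ?a = "harm_coeff T l' (int k') \<omega>" and ?b = "harm_coeff T l' (int k') \<omega>"]
      by (fastforce simp: sum_subtractf)
  qed
  \<comment> \<open>\<open>s\<close> is the factor with which order \<open>-k\<close> enters, zero
    when \<open>k = 0\<close> has no partner; \<open>u\<close> and \<open>v\<close> are the
    coefficients of the real and the imaginary part.\<close>
  define s :: complex where "s = (if k = 0 then 0 else (-1) ^ k)"
  define u where "u = G l (int k) + s * G l (- int k) - d (l, k)"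
  define v where "v = \<i> * (G l (int k) - s * G l (- int k) - d (l, k))"
  have lin: "H (l, k) z = u * of_real (Re z) + v * of_real (Im z)" for z
  proof -
    have z: "z = of_real (Re z) + \<i> * of_real (Im z)" "cnj z = of_real (Re z) - \<i> * of_real (Im z)"
      by (simp_all add: complex_eq_iff)
    have "H (l, k) z = z * G l (int k) + s * cnj z * G l (- int k) - d (l, k) * z"
      by (simp add: H_def paired_term_def s_def)
    also have "\<dots> = u * of_real (Re z) + v * of_real (Im z)"
      unfolding u_def v_def by (subst (1 2) z(1), subst z(2)) (simp add: algebra_simps)
    finally show ?thesis .
  qed
  have uv: "u = 0 \<and> (k \<noteq> 0 \<longrightarrow> v = 0)"
  proof (rule ccontr)
    assume "\<not> ?thesis"
    then have nd: "u \<noteq> 0 \<or> k \<noteq> 0 \<and> v \<noteq> 0" by auto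
    have "AE \<omega> in M. coeff (l, k) \<omega> \<in> UNIV \<longrightarrow> \<not> (\<lambda>l. \<Sum>k\<le>l. H (l, k) (coeff (l, k) \<omega>)) sums 0"
    proof (rule AE_indep_series_not_sums_zero[OF indep_coeff])
      show "H i \<in> borel_measurable borel" for i
        unfolding H_def[abs_def] by measurable
      show "prob {\<omega> \<in> space M. coeff (l, k) \<omega> \<in> UNIV \<and> H (l, k) (coeff (l, k) \<omega>) = w} = 0" for w
        using prob_coeff_linear_eq_0[OF assms(1) nd, of w] by (simp add: lin)
    qed (use assms in auto)
    with zero have "AE \<omega> in M. False" by eventually_elim simp
    then show False by simp
  qed
  have G: "G l (int k) = d (l, k)" "k \<noteq> 0 \<Longrightarrow> G l (- int k) = 0"
  proof -
    show "G l (int k) = d (l, k)"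
    proof (cases "k = 0")
      case True
      then show ?thesis using uv by (simp add: u_def s_def)
    next
      case False
      then have "u = 0" "v = 0" using uv by auto
      then have "G l (int k) + s * G l (- int k) - d (l, k) = 0" "G l (int k) - s * G l (- int k) - d (l, k) = 0"
        by (simp_all add: u_def v_def)
      then have "2 * (G l (int k) - d (l, k)) = 0" by algebra
      then show ?thesis by simp
    qed
    moreover assume "k \<noteq> 0"
    ultimately show "G l (- int k) = 0" using uv by (simp add: u_def s_def)
  qed
  then show "sph_coeff (sph_harm l (int k)) l' (int k') = (if (l, k) = (l', k') then 1 else 0)"
    "k \<noteq> 0 \<Longrightarrow> sph_coeff (sph_harm l (- int k)) l' (int k') = 0"
    by (simp_all add: G_def d_def)
qed

text \<open>Conjugating both harmonics reverses both orders at once, which reduces a negative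
  \<open>m'\<close> to the nonnegative orders already treated.\<close>

sublocale orthonormal_harmonics
proof
  fix l l' :: nat and m m' :: int
  assume m: "\<bar>m\<bar> \<le> int l" and m': "\<bar>m'\<bar> \<le> int l'"
  have nonneg: "sph_coeff (sph_harm l m) l' (int k') = (if l = l' \<and> m = int k' then 1 else 0)"
    if m: "\<bar>m\<bar> \<le> int l" and k': "k' \<le> l'" for m k'
  proof (cases "m \<ge> 0")
    case True
    then show ?thesis
      using gram_nonneg_order(1)[of "nat m" l k' l'] m k' by auto
  next
    case False
    then show ?thesis
      using gram_nonneg_order(2)[of "nat (- m)" l k' l'] m k' by auto
  qed
  show "sph_coeff (sph_harm l m) l' m' = (if l = l' \<and> m = m' then 1 else 0)"
  proof (cases "m' \<ge> 0")
    case True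
    then show ?thesis using nonneg[of m "nat m'"] m m' by simp
  next
    case False
    then have "sph_coeff (sph_harm l (- m)) l' (- m') = (if l = l' \<and> m = m' then 1 else 0)"
      using nonneg[of "- m" "nat (- m')"] m m' by auto
    then show ?thesis
      using sph_coeff_sph_harm_minus[of l "- m" l' "- m'"]
      by (auto simp: power2_eq_square simp flip: power_mult_distrib split: if_splits)
  qed
qed

end

section \<open>The regularized field\<close>

text \<open>Thresholding multiplies by a real factor that depends on the modulus alone, so the
  regularized coefficients keep the symmetry between \<open>k\<close> and \<open>-k\<close>, and
  \<open>paired_term\<close> applies to them.\<close>

lemma soft_threshold_cnj:
  "soft_threshold lam ((-1) ^ k * cnj z) = (-1) ^ k * cnj (soft_threshold lam z)"
  by (simp add: soft_threshold_def norm_mult norm_power)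

lemma borel_measurable_soft_threshold [measurable]: "soft_threshold lam \<in> borel_measurable borel"
  unfolding soft_threshold_def[abs_def] by measurable

lemma Re_soft_threshold_pos:
  assumes "lam > 0" "lam < Re z"
  shows "Re (soft_threshold lam z) > 0"
proof -
  have "lam < cmod z"
    using assms complex_Re_le_cmod[of z] by linarith
  then have "soft_threshold lam z = of_real (1 - lam / cmod z) * z" and "1 - lam / cmod z > 0"
    using assms by (auto simp: soft_threshold_def divide_less_eq_1)
  then show ?thesis
    using assms by (simp add: mult_pos_pos del: of_real_diff)
qed

text \<open>Above the level, thresholding keeps the direction and lowers the modulus by
  \<open>lam\<close>. The explicit inverse recovers a large coefficient from its thresholded
  value.\<close>

lemma soft_threshold_inj:
  assumes "lam > 0" "cmod z > lam"
  shows "z = of_real ((cmod (soft_threshold lam z) + lam) / cmod (soft_threshold lam z)) * soft_threshold lam z"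
proof -
  have z: "cmod z > 0" using assms by linarith
  have s: "soft_threshold lam z = of_real (1 - lam / cmod z) * z"
    using assms by (simp add: soft_threshold_def)
  have c: "cmod (soft_threshold lam z) = cmod z - lam"
    unfolding s norm_mult norm_of_real using assms z by (simp add: field_simps)
  have one: "(cmod z - lam + lam) / (cmod z - lam) * (1 - lam / cmod z) = 1"
    using assms z by (simp add: field_simps)
  have "z = of_real ((cmod z - lam + lam) / (cmod z - lam) * (1 - lam / cmod z)) * z"
    by (simp only: one of_real_1 mult_1_left)
  also have "\<dots> = of_real ((cmod z - lam + lam) / (cmod z - lam)) * soft_threshold lam z"
    by (simp only: s of_real_mult mult.assoc)
  finally show ?thesis
    by (simp only: c)
qed

text \<open>The weight \<open>Suc l\<close> counts the independent coefficients of degree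
  \<open>l\<close>, one for each order from \<open>0\<close> to \<open>l\<close>.\<close>

locale thresholded_field = spectral_field M T C
  for M :: "'w measure" and T :: "'w \<Rightarrow> real^3 \<Rightarrow> real" and C :: "nat \<Rightarrow> real" +
  fixes lam :: real
  assumes lam_pos: "lam > 0"
    and C_summable: "summable (\<lambda>l. real (Suc l) * C l)"
begin

abbreviation X :: "'w \<Rightarrow> real^3 \<Rightarrow> complex" where "X \<equiv> reg_field lam T"

lemma field_measurable_pair [measurable]:
  "(\<lambda>p. T (fst p) (snd p)) \<in> borel_measurable (M \<Otimes>\<^sub>M sphere_measure)"
  using field by (simp add: random_field_def split_def)

lemma borel_measurable_field:
  assumes "\<omega> \<in> space M"
  shows "T \<omega> \<in> borel_measurable sphere_measure"
  using measurable_compose[OF measurable_Pair1'[OF assms] field_measurable_pair]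
  by simp

lemma borel_measurable_harm_coeff [measurable]: "harm_coeff T l m \<in> borel_measurable M"
  unfolding harm_coeff_def[abs_def] split_def
  by (rule sphere.borel_measurable_lebesgue_integral) (unfold split_def, measurable)

lemma AE_square_integrable: "AE \<omega> in M. square_integrable sphere_measure (cfield \<omega>)"
  using AE_L2_sums by eventually_elim (simp add: L2_sums_iff)

text \<open>A formula valid at every outcome, split along a measurable condition, from which joint
  measurability can be read off.\<close>

lemma reg_field_eq:
  assumes "\<omega> \<in> space M"
  shows "X \<omega> x = (if (\<integral>\<^sup>+y. ennreal ((T \<omega> y)\<^sup>2) \<partial>sphere_measure) < \<infinity>
    then \<Sum>l. \<Sum>m\<in>{- int l..int l}. soft_threshold lam (harm_coeff T l m \<omega>) * sph_harm l m x
    else \<Sum>l. \<Sum>m\<in>{- int l..int l}. arg_min (\<lambda>_. \<infinity> :: ennreal) harmonic_array l m * sph_harm l m x)"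
proof -
  note [measurable] = borel_measurable_field[OF assms]
  have meas: "cfield \<omega> \<in> borel_measurable sphere_measure" by measurable
  have iff: "square_integrable sphere_measure (cfield \<omega>)
      \<longleftrightarrow> (\<integral>\<^sup>+y. ennreal ((T \<omega> y)\<^sup>2) \<partial>sphere_measure) < \<infinity>"
    unfolding square_integrable_def integrable_iff_bounded by simp
  show ?thesis
  proof (cases "square_integrable sphere_measure (cfield \<omega>)")
    case True
    have "X \<omega> x = (\<Sum>l. \<Sum>m\<in>{- int l..int l}. soft_threshold lam (harm_coeff T l m \<omega>) * sph_harm l m x)"
      unfolding reg_field_def reg_coeff_eq_soft_array[OF lam_pos True] harm_coeff_eq
      by (intro suminf_cong sum.cong) (auto simp: soft_array_def)
    then show ?thesis using True iff by simp
  next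
    case False
    then show ?thesis
      using iff reg_coeff_not_square_integrable[OF lam_pos meas False] by (simp add: reg_field_def)
  qed
qed

lemma random_field_reg_field: "random_field M X"
proof -
  have [measurable]: "sph_harm l m \<in> borel_measurable sphere_measure" for l m
    by (rule borel_measurable_sph_harm')
  have [measurable]: "(\<lambda>\<omega>. \<integral>\<^sup>+y. ennreal ((T \<omega> y)\<^sup>2) \<partial>sphere_measure) \<in> borel_measurable M"
    by (rule sphere.borel_measurable_nn_integral) (unfold split_def, measurable)
  have "(\<lambda>p. if (\<integral>\<^sup>+y. ennreal ((T (fst p) y)\<^sup>2) \<partial>sphere_measure) < \<infinity>
    then \<Sum>l. \<Sum>m\<in>{- int l..int l}. soft_threshold lam (harm_coeff T l m (fst p)) * sph_harm l m (snd p)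
    else \<Sum>l. \<Sum>m\<in>{- int l..int l}. arg_min (\<lambda>_. \<infinity> :: ennreal) harmonic_array l m * sph_harm l m (snd p))
    \<in> borel_measurable (M \<Otimes>\<^sub>M sphere_measure)"
    by measurable
  then show ?thesis
    unfolding random_field_def split_def
    by (rule measurable_cong[THEN iffD1, rotated]) (simp add: space_pair_measure reg_field_eq mem_Times_iff)
qed

lemma borel_measurable_reg_field:
  assumes "x \<in> S2"
  shows "(\<lambda>\<omega>. X \<omega> x) \<in> borel_measurable M"
proof -
  have "x \<in> space sphere_measure" using assms by simp
  from measurable_compose[OF measurable_Pair2'[OF this] random_field_reg_field[unfolded random_field_def]]
  show ?thesis by simp
qed

text \<open>Only finitely many thresholded coefficients are nonzero, so the series converges at
  every point \<open>x\<close> and not merely in mean square.\<close>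

lemma reg_field_sums:
  assumes si: "square_integrable sphere_measure (cfield \<omega>)"
  shows "(\<lambda>l. \<Sum>k\<le>l. paired_term (\<lambda>l m. sph_harm l m x) l k (soft_threshold lam (coeff (l, k) \<omega>)))
    sums X \<omega> x"
proof -
  let ?s = "\<lambda>l m. soft_array lam (sph_coeff (cfield \<omega>)) l m"
  obtain L where L: "\<And>l m. l \<ge> L \<Longrightarrow> ?s l m = 0"
    using soft_array_eventually_zero[OF lam_pos si] by blast
  have "(\<lambda>l. \<Sum>m\<in>{- int l..int l}. ?s l m * sph_harm l m x) sums X \<omega> x"
    unfolding reg_field_def reg_coeff_eq_soft_array[OF lam_pos si]
    by (intro summable_sums summable_finite[of "{..<L}"]) (auto simp: L)
  moreover have "(\<Sum>m\<in>{- int l..int l}. ?s l m * sph_harm l m x)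
      = (\<Sum>k\<le>l. paired_term (\<lambda>l m. sph_harm l m x) l k (soft_threshold lam (coeff (l, k) \<omega>)))" for l
  proof -
    have "(\<Sum>m\<in>{- int l..int l}. ?s l m * sph_harm l m x)
        = (\<Sum>m\<in>{- int l..int l}. soft_threshold lam (harm_coeff T l m \<omega>) * sph_harm l m x)"
      by (intro sum.cong) (auto simp: soft_array_def harm_coeff_eq)
    also have "\<dots> = (\<Sum>k\<le>l. paired_term (\<lambda>l m. sph_harm l m x) l k (soft_threshold lam (harm_coeff T l (int k) \<omega>)))"
      by (rule sum_eq_sum_paired_term) (simp add: harm_coeff_minus soft_threshold_cnj)
    finally show ?thesis by simp
  qed
  ultimately show ?thesis by simp
qed

lemma reg_field_single_term:
  assumes si: "square_integrable sphere_measure (cfield \<omega>)" and "k\<^sub>0 \<le> l\<^sub>0"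
    and small: "\<And>l k. k \<le> l \<Longrightarrow> (l, k) \<noteq> (l\<^sub>0, k\<^sub>0) \<Longrightarrow> cmod (coeff (l, k) \<omega>) \<le> lam"
  shows "X \<omega> x = paired_term (\<lambda>l m. sph_harm l m x) l\<^sub>0 k\<^sub>0 (soft_threshold lam (coeff (l\<^sub>0, k\<^sub>0) \<omega>))"
    (is "_ = ?p")
proof -
  have "(\<Sum>k\<le>l. paired_term (\<lambda>l m. sph_harm l m x) l k (soft_threshold lam (coeff (l, k) \<omega>)))
      = (if l = l\<^sub>0 then ?p else 0)" for l
  proof -
    have "(\<Sum>k\<le>l. paired_term (\<lambda>l m. sph_harm l m x) l k (soft_threshold lam (coeff (l, k) \<omega>)))
        = (\<Sum>k\<le>l. if k = k\<^sub>0 then if l = l\<^sub>0 then ?p else 0 else 0)"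
    proof (rule sum.cong[OF refl])
      fix k assume "k \<in> {..l}"
      then show "paired_term (\<lambda>l m. sph_harm l m x) l k (soft_threshold lam (coeff (l, k) \<omega>))
          = (if k = k\<^sub>0 then if l = l\<^sub>0 then ?p else 0 else 0)"
        using small[of k l] by (auto simp: soft_threshold_def)
    qed
    then show ?thesis using \<open>k\<^sub>0 \<le> l\<^sub>0\<close> by simp
  qed
  then have "(\<lambda>l. if l = l\<^sub>0 then ?p else 0) sums X \<omega> x"
    using reg_field_sums[OF si, of x] by simp
  then show ?thesis
    using sums_single[of l\<^sub>0 "\<lambda>_. ?p"] sums_unique2 by blast
qed

section \<open>Positive probability of prescribed threshold patterns\<close>

text \<open>Chebyshev. For \<open>k\<close> nonzero, a modulus above \<open>lam\<close> forces the
  real or the imaginary part to reach \<open>lam / 2\<close>; two parts of variance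
  \<open>C l / 2\<close> produce the constant \<open>4\<close>, which also covers
  \<open>k = 0\<close>.\<close>

lemma prob_coeff_large_le:
  assumes "k \<le> l"
  shows "prob {\<omega> \<in> space M. cmod (coeff (l, k) \<omega>) > lam} \<le> 4 * C l / lam\<^sup>2"
proof (cases "k = 0")
  case True
  have "prob {\<omega> \<in> space M. cmod (coeff (l, k) \<omega>) > lam}
      \<le> prob {\<omega> \<in> space M. \<bar>Re (harm_coeff T l 0 \<omega>)\<bar> \<ge> lam}"
    using True by (intro finite_measure_mono) (auto simp: cmod_def coeff_zero_real)
  also have "\<dots> \<le> (sqrt (C l))\<^sup>2 / lam\<^sup>2"
    by (rule prob_normal_ge_le[OF coeff_zero_distr]) (use C_pos lam_pos in auto)
  also have "\<dots> \<le> 4 * C l / lam\<^sup>2"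
    using C_pos[of l] by (intro divide_right_mono) auto
  finally show ?thesis .
next
  case False
  note distr = coeff_Re_distr[OF False assms] coeff_Im_distr[OF False assms]
  let ?R = "{\<omega> \<in> space M. \<bar>Re (coeff (l, k) \<omega>)\<bar> \<ge> lam / 2}"
  let ?I = "{\<omega> \<in> space M. \<bar>Im (coeff (l, k) \<omega>)\<bar> \<ge> lam / 2}"
  have "prob {\<omega> \<in> space M. cmod (coeff (l, k) \<omega>) > lam} \<le> prob (?R \<union> ?I)"
  proof (rule finite_measure_mono)
    show "{\<omega> \<in> space M. cmod (coeff (l, k) \<omega>) > lam} \<subseteq> ?R \<union> ?I"
    proof
      fix \<omega> assume "\<omega> \<in> {\<omega> \<in> space M. cmod (coeff (l, k) \<omega>) > lam}"
      then show "\<omega> \<in> ?R \<union> ?I"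
        using cmod_le[of "coeff (l, k) \<omega>"] by auto
    qed
  qed measurable
  also have "\<dots> \<le> prob ?R + prob ?I"
    by (rule measure_Un_le) measurable
  also have "\<dots> \<le> (sqrt (C l / 2))\<^sup>2 / (lam / 2)\<^sup>2 + (sqrt (C l / 2))\<^sup>2 / (lam / 2)\<^sup>2"
    by (intro add_mono prob_normal_ge_le distr) (use C_pos lam_pos in auto)
  also have "\<dots> = 4 * C l / lam\<^sup>2"
    using C_pos[of l] lam_pos by (simp add: power_divide field_simps)
  finally show ?thesis .
qed

lemma prob_coeff_small_pos:
  assumes "k \<le> l"
  shows "prob {\<omega> \<in> space M. coeff (l, k) \<omega> \<in> {z. cmod z \<le> lam}} > 0"
proof (cases "k = 0")
  case True
  have "0 < prob {\<omega> \<in> space M. Re (harm_coeff T l 0 \<omega>) \<in> {- lam<..<lam}}"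
    by (rule prob_normal_pos[OF coeff_zero_distr]) (use C_pos lam_pos in auto)
  also have "\<dots> \<le> prob {\<omega> \<in> space M. coeff (l, k) \<omega> \<in> {z. cmod z \<le> lam}}"
    using True by (intro finite_measure_mono) (auto simp: cmod_def coeff_zero_real)
  finally show ?thesis .
next
  case False
  let ?J = "{- lam / 2<..<lam / 2}"
  have "0 < prob {\<omega> \<in> space M. Re (coeff (l, k) \<omega>) \<in> ?J} * prob {\<omega> \<in> space M. Im (coeff (l, k) \<omega>) \<in> ?J}"
    by (intro mult_pos_pos prob_normal_pos[OF coeff_Re_distr[OF False assms]]
        prob_normal_pos[OF coeff_Im_distr[OF False assms]]) (use C_pos lam_pos in auto)
  also have "\<dots> = prob {\<omega> \<in> space M. Re (coeff (l, k) \<omega>) \<in> ?J \<and> Im (coeff (l, k) \<omega>) \<in> ?J}"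
    by (rule prob_indep_random_variable[OF coeff_indep[OF False assms], symmetric]) auto
  also have "\<dots> \<le> prob {\<omega> \<in> space M. coeff (l, k) \<omega> \<in> {z. cmod z \<le> lam}}"
  proof (rule finite_measure_mono)
    show "{\<omega> \<in> space M. Re (coeff (l, k) \<omega>) \<in> ?J \<and> Im (coeff (l, k) \<omega>) \<in> ?J}
        \<subseteq> {\<omega> \<in> space M. coeff (l, k) \<omega> \<in> {z. cmod z \<le> lam}}"
    proof
      fix \<omega> assume "\<omega> \<in> {\<omega> \<in> space M. Re (coeff (l, k) \<omega>) \<in> ?J \<and> Im (coeff (l, k) \<omega>) \<in> ?J}"
      then show "\<omega> \<in> {\<omega> \<in> space M. coeff (l, k) \<omega> \<in> {z. cmod z \<le> lam}}"
        using cmod_le[of "coeff (l, k) \<omega>"] by auto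
    qed
  qed measurable
  finally show ?thesis .
qed

lemma prob_coeff_large_pos:
  assumes "k \<le> l"
  shows "prob {\<omega> \<in> space M. coeff (l, k) \<omega> \<in> {z. lam < Re z}} > 0"
proof -
  obtain \<sigma> where "\<sigma> > 0" "distributed M lborel (\<lambda>\<omega>. Re (coeff (l, k) \<omega>)) (normal_density 0 \<sigma>)"
  proof (cases "k = 0")
    case True
    then show ?thesis using that[of "sqrt (C l)"] coeff_zero_distr C_pos by simp
  next
    case False
    then show ?thesis using that[OF _ coeff_Re_distr[OF False assms]] C_pos by simp
  qed
  then have "0 < prob {\<omega> \<in> space M. Re (coeff (l, k) \<omega>) \<in> {lam<..<lam + 1}}"
    by (intro prob_normal_pos) auto
  also have "\<dots> \<le> prob {\<omega> \<in> space M. coeff (l, k) \<omega> \<in> {z. lam < Re z}}"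
    by (rule finite_measure_mono) auto
  finally show ?thesis .
qed

text \<open>Only finitely many coefficients may be required to be large, so beyond degree
  \<open>n\<^sub>1\<close> the failure probabilities are dominated by a summable series. Starting
  the tail where its sum is below \<open>1\<close> leaves a positive product.\<close>

lemma prob_coeffs_pos:
  assumes B: "\<And>i. B i \<in> {{z. cmod z \<le> lam}, {z. lam < Re z}}"
    and fin: "\<And>l k. l \<ge> n\<^sub>1 \<Longrightarrow> B (l, k) = {z. cmod z \<le> lam}"
  shows "prob {\<omega> \<in> space M. \<forall>i\<in>{(l, k). k \<le> l}. coeff i \<omega> \<in> B i} > 0"
proof -
  define F :: "nat \<Rightarrow> (nat \<times> nat) set" where "F n = (SIGMA l:{..<n}. {..l})" for n
  \<comment> \<open>The Chebyshev bound summed over the \<open>Suc l\<close> orders of degree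
    \<open>l\<close>.\<close>
  define c where "c l = real (Suc l) * C l * (4 / lam\<^sup>2)" for l
  have c: "summable c" "\<And>l. c l \<ge> 0"
    unfolding c_def using C_summable C_pos by (auto intro: summable_mult2 simp: less_imp_le)
  obtain n\<^sub>2 where n\<^sub>2: "\<And>n. norm (\<Sum>l. c (l + n\<^sub>2)) < 1"
    using suminf_exist_split[OF zero_less_one c(1)] by blast
  define n\<^sub>0 where "n\<^sub>0 = max n\<^sub>1 n\<^sub>2"
  define q where "q i = 1 - prob {\<omega> \<in> space M. coeff i \<omega> \<in> B i}" for i
  have small: "q (l, k) \<le> 4 * C l / lam\<^sup>2" if "l \<ge> n\<^sub>1" "k \<le> l" for l k
  proof -
    have "q (l, k) = prob (space M - {\<omega> \<in> space M. coeff (l, k) \<omega> \<in> {z. cmod z \<le> lam}})"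
      unfolding q_def fin[OF that(1)] by (rule prob_compl[symmetric]) measurable
    also have "space M - {\<omega> \<in> space M. coeff (l, k) \<omega> \<in> {z. cmod z \<le> lam}}
        = {\<omega> \<in> space M. cmod (coeff (l, k) \<omega>) > lam}"
      by auto
    also have "prob \<dots> \<le> 4 * C l / lam\<^sup>2"
      by (rule prob_coeff_large_le[OF that(2)])
    finally show ?thesis .
  qed
  have tail: "(\<Sum>i\<in>F n - F n\<^sub>0. q i) \<le> (\<Sum>l. c (l + n\<^sub>2))" for n
  proof -
    have "(\<Sum>i\<in>F n - F n\<^sub>0. q i) = (\<Sum>i\<in>(SIGMA l:{n\<^sub>0..<n}. {..l}). q i)"
      by (intro sum.cong) (auto simp: F_def)
    also have "\<dots> = (\<Sum>l\<in>{n\<^sub>0..<n}. \<Sum>k\<le>l. q (l, k))"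
      by (subst sum.Sigma) auto
    also have "\<dots> \<le> (\<Sum>l\<in>{n\<^sub>0..<n}. \<Sum>k\<le>l. 4 * C l / lam\<^sup>2)"
      by (intro sum_mono small) (auto simp: n\<^sub>0_def)
    also have "\<dots> = (\<Sum>l\<in>{n\<^sub>0..<n}. c l)"
      by (simp add: c_def mult_ac)
    also have "\<dots> \<le> (\<Sum>l\<in>{n\<^sub>2..<n + n\<^sub>2}. c l)"
      by (intro sum_mono2) (auto simp: n\<^sub>0_def c)
    also have "\<dots> = (\<Sum>l<n. c (l + n\<^sub>2))"
      using sum.shift_bounds_nat_ivl[of c 0 n\<^sub>2 n] by (simp add: atLeast0LessThan)
    also have "\<dots> \<le> (\<Sum>l. c (l + n\<^sub>2))"
      by (intro sum_le_suminf) (use c in \<open>auto simp: summable_iff_shift\<close>)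
    finally show ?thesis .
  qed
  show ?thesis
  proof (rule prob_indep_vars_Ball_pos[OF indep_coeff, where F = F and n\<^sub>0 = n\<^sub>0 and c = "\<Sum>l. c (l + n\<^sub>2)"])
    show "finite (F n)" for n by (auto simp: F_def)
    show "incseq F" by (auto simp: F_def incseq_def)
    show "(\<Union>n. F n) = {(l, k). k \<le> l}" by (auto simp: F_def)
    show "B i \<in> sets borel" for i
      using B[of i] by auto
    show "prob {\<omega> \<in> space M. coeff i \<omega> \<in> B i} > 0" if "i \<in> {(l, k). k \<le> l}" for i
      using B[of i] that prob_coeff_small_pos[of "snd i" "fst i"] prob_coeff_large_pos[of "snd i" "fst i"]
      by auto
    show "(\<Sum>i\<in>F n - F n\<^sub>0. 1 - prob {\<omega> \<in> space M. coeff i \<omega> \<in> B i}) \<le> (\<Sum>l. c (l + n\<^sub>2))" for n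
      using tail[of n] by (simp add: q_def)
    show "(\<Sum>l. c (l + n\<^sub>2)) < 1" using n\<^sub>2 by (simp add: abs_less_iff)
  qed
qed

definition all_small :: "'w set" where
  "all_small = {\<omega> \<in> space M. \<forall>l k. k \<le> l \<longrightarrow> cmod (coeff (l, k) \<omega>) \<le> lam}"

text \<open>The large coefficient is constrained through its real part: this makes it exceed the
  level and also gives the thresholded value a nonzero real part, which is what the pair of orders
  \<open>1\<close> and \<open>-1\<close> depends on at the point chosen for anisotropy.\<close>

definition one_large :: "nat \<Rightarrow> nat \<Rightarrow> 'w set" where
  "one_large l\<^sub>0 k\<^sub>0 = {\<omega> \<in> space M. lam < Re (coeff (l\<^sub>0, k\<^sub>0) \<omega>) \<and>
     (\<forall>l k. k \<le> l \<longrightarrow> (l, k) \<noteq> (l\<^sub>0, k\<^sub>0) \<longrightarrow> cmod (coeff (l, k) \<omega>) \<le> lam)}"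

lemma prob_all_small_pos: "prob all_small > 0"
  using prob_coeffs_pos[of "\<lambda>_. {z. cmod z \<le> lam}" 0] by (simp add: all_small_def)

lemma prob_one_large_pos:
  assumes "k\<^sub>0 \<le> l\<^sub>0"
  shows "prob (one_large l\<^sub>0 k\<^sub>0) > 0"
proof -
  define B where "B i = (if i = (l\<^sub>0, k\<^sub>0) then {z. lam < Re z} else {z. cmod z \<le> lam})" for i
  have "prob {\<omega> \<in> space M. \<forall>i\<in>{(l, k). k \<le> l}. coeff i \<omega> \<in> B i} > 0"
    by (rule prob_coeffs_pos[where n\<^sub>1 = "Suc l\<^sub>0"]) (auto simp: B_def)
  also have "{\<omega> \<in> space M. \<forall>i\<in>{(l, k). k \<le> l}. coeff i \<omega> \<in> B i} = one_large l\<^sub>0 k\<^sub>0"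
    using assms by (auto simp: B_def one_large_def split: if_splits)
  finally show ?thesis .
qed

lemma sets_one_large [measurable]: "one_large l\<^sub>0 k\<^sub>0 \<in> events"
  unfolding one_large_def by measurable

lemma AE_all_small: "AE \<omega> in M. \<omega> \<in> all_small \<longrightarrow> X \<omega> x = 0"
  using AE_square_integrable
proof eventually_elim
  case (elim \<omega>)
  show ?case
  proof
    assume small: "\<omega> \<in> all_small"
    then have "cmod (coeff (0, 0) \<omega>) \<le> lam"
      unfolding all_small_def by blast
    then show "X \<omega> x = 0"
      using reg_field_single_term[OF elim, of 0 0 x] small by (simp add: all_small_def soft_threshold_def)
  qed
qed

lemma AE_one_large:
  assumes "k\<^sub>0 \<le> l\<^sub>0"
  shows "AE \<omega> in M. \<omega> \<in> one_large l\<^sub>0 k\<^sub>0 \<longrightarrow>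
    X \<omega> x = paired_term (\<lambda>l m. sph_harm l m x) l\<^sub>0 k\<^sub>0 (soft_threshold lam (coeff (l\<^sub>0, k\<^sub>0) \<omega>)) \<and>
    Re (soft_threshold lam (coeff (l\<^sub>0, k\<^sub>0) \<omega>)) > 0"
  using AE_square_integrable
proof eventually_elim
  case (elim \<omega>)
  then show ?case
    using reg_field_single_term[of \<omega> k\<^sub>0 l\<^sub>0 x] assms Re_soft_threshold_pos[OF lam_pos]
    by (auto simp: one_large_def)
qed

lemma not_gaussian_reg_field: "\<not> gaussian_field M X"
proof
  assume "gaussian_field M X"
  define x :: "real^3" where "x = axis 3 1"
  have x: "x \<in> S2" by (simp add: x_def)
  define Z where "Z \<omega> = Re (X \<omega> x)" for \<omega>
  have [measurable]: "Z \<in> borel_measurable M"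
    unfolding Z_def using borel_measurable_reg_field[OF x] by measurable
  \<comment> \<open>The real inner product with \<open>1\<close> extracts the real part at one
    point.\<close>
  have "gaussian_rv M (\<lambda>\<omega>. \<Sum>y\<in>{x}. 1 \<bullet> X \<omega> y)"
    using \<open>gaussian_field M X\<close>[unfolded gaussian_field_def, rule_format, of "{x}" "\<lambda>_. 1"] x by simp
  then have Z: "gaussian_rv M Z"
    by (simp add: Z_def[abs_def] inner_complex_def)
  have "0 < prob all_small" by (rule prob_all_small_pos)
  also have "\<dots> \<le> prob {\<omega> \<in> space M. Z \<omega> = 0}"
  proof (rule finite_measure_mono_AE)
    show "AE \<omega> in M. \<omega> \<in> all_small \<longrightarrow> \<omega> \<in> {\<omega> \<in> space M. Z \<omega> = 0}"
      using AE_all_small[of x] by eventually_elim (auto simp: Z_def all_small_def)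
  qed measurable
  finally have pos: "0 < prob {\<omega> \<in> space M. Z \<omega> = 0}" .
  have Y: "sph_harm 0 0 x = of_real (sqrt (1 / (4 * pi)))"
    by (simp add: sph_harm_def sph_harm_nonneg_def legendre_def)
  have "0 < prob (one_large 0 0)" by (rule prob_one_large_pos) simp
  also have "\<dots> \<le> prob {\<omega> \<in> space M. Z \<omega> \<noteq> 0}"
  proof (rule finite_measure_mono_AE)
    show "AE \<omega> in M. \<omega> \<in> one_large 0 0 \<longrightarrow> \<omega> \<in> {\<omega> \<in> space M. Z \<omega> \<noteq> 0}"
      using AE_one_large[of 0 0 x, OF order_refl]
      by eventually_elim (auto simp: Z_def paired_term_def Y one_large_def)
  qed measurable
  finally have pos': "0 < prob {\<omega> \<in> space M. Z \<omega> \<noteq> 0}" .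
  consider \<mu> where "AE \<omega> in M. Z \<omega> = \<mu>"
    | \<mu> \<sigma> where "\<sigma> > 0" "distributed M lborel Z (normal_density \<mu> \<sigma>)"
    using Z by (auto simp: gaussian_rv_def)
  then show False
  proof cases
    case 1
    \<comment> \<open>A constant must sit at the atom, hence be zero, and this contradicts
      \<open>pos'\<close>.\<close>
    have "prob {\<omega> \<in> space M. Z \<omega> = c} = 0" if "c \<noteq> \<mu>" for c
      using 1 that by (subst prob_eq_0) (auto elim!: eventually_mono)
    then have "\<mu> = 0" using pos by fastforce
    then have "prob {\<omega> \<in> space M. Z \<omega> \<noteq> 0} = 0"
      using 1 by (subst prob_eq_0) (auto elim!: eventually_mono)
    then show False using pos' by simp
  next
    case 2
    then show False using prob_normal_eq_0[of Z \<mu> \<sigma> 0] pos by simp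
  qed
qed

text \<open>Given that the coefficient is large, its thresholded value is an injective image of it
  and so has no atoms; multiplied by the nonzero \<open>sph_harm l 0 x\<close>, it cannot cancel the
  independent remainder of the series.\<close>

lemma AE_reg_field_nonzero:
  assumes x: "sph_harm l 0 x \<noteq> 0"
  shows "AE \<omega> in M. lam < cmod (coeff (l, 0) \<omega>) \<longrightarrow> X \<omega> x \<noteq> 0"
proof -
  define H where "H i z = paired_term (\<lambda>l m. sph_harm l m x) (fst i) (snd i) (soft_threshold lam z)" for i z
  have "AE \<omega> in M. coeff (l, 0) \<omega> \<in> {z. lam < cmod z} \<longrightarrow>
      \<not> (\<lambda>l. \<Sum>k\<le>l. H (l, k) (coeff (l, k) \<omega>)) sums 0"
  proof (rule AE_indep_series_not_sums_zero[OF indep_coeff])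
    show "H i \<in> borel_measurable borel" for i
      unfolding H_def[abs_def] by measurable
    show "prob {\<omega> \<in> space M. coeff (l, 0) \<omega> \<in> {z. lam < cmod z} \<and> H (l, 0) (coeff (l, 0) \<omega>) = w} = 0" for w
    proof -
      \<comment> \<open>\<open>s\<close> is the only thresholded coefficient compatible with the
        value \<open>w\<close>, and \<open>c\<close> is its preimage above the level.\<close>
      define s where "s = w / sph_harm l 0 x"
      define c where "c = of_real ((cmod s + lam) / cmod s) * s"
      have "{\<omega> \<in> space M. coeff (l, 0) \<omega> \<in> {z. lam < cmod z} \<and> H (l, 0) (coeff (l, 0) \<omega>) = w}
          \<subseteq> {\<omega> \<in> space M. Re (harm_coeff T l 0 \<omega>) = Re c}"
      proof
        fix \<omega> assume "\<omega> \<in> {\<omega> \<in> space M. coeff (l, 0) \<omega> \<in> {z. lam < cmod z} \<and> H (l, 0) (coeff (l, 0) \<omega>) = w}"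
        then have \<omega>: "\<omega> \<in> space M" "lam < cmod (harm_coeff T l 0 \<omega>)" "H (l, 0) (harm_coeff T l 0 \<omega>) = w"
          by simp_all
        then have "s = soft_threshold lam (harm_coeff T l 0 \<omega>)"
          using x by (simp add: s_def H_def paired_term_def field_simps)
        then have "harm_coeff T l 0 \<omega> = c"
          unfolding c_def using soft_threshold_inj[OF lam_pos \<omega>(2)] by metis
        then show "\<omega> \<in> {\<omega> \<in> space M. Re (harm_coeff T l 0 \<omega>) = Re c}" using \<omega>(1) by simp
      qed
      then have "prob {\<omega> \<in> space M. coeff (l, 0) \<omega> \<in> {z. lam < cmod z} \<and> H (l, 0) (coeff (l, 0) \<omega>) = w}
          \<le> prob {\<omega> \<in> space M. Re (harm_coeff T l 0 \<omega>) = Re c}"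
        by (rule finite_measure_mono) measurable
      then show ?thesis
        by (simp only: prob_normal_eq_0[OF coeff_zero_distr] measure_le_0_iff)
    qed
  qed auto
  with AE_square_integrable show ?thesis
  proof eventually_elim
    case (elim \<omega>)
    then show ?case
      using reg_field_sums[of \<omega> x] by (auto simp: H_def)
  qed
qed

end

section \<open>Zeros of Legendre polynomials, rotations and anisotropy\<close>

lemma higher_pderiv_nonzero:
  fixes p :: "real poly"
  assumes "p \<noteq> 0" "k \<le> degree p"
  shows "(pderiv ^^ k) p \<noteq> 0 \<and> degree ((pderiv ^^ k) p) = degree p - k"
  using assms(2)
proof (induction k)
  case (Suc k)
  then show ?case by (auto simp: pderiv_eq_0_iff degree_pderiv)
qed (use assms in simp)

lemma legendre_nonzero: "legendre l \<noteq> 0"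
proof -
  have "degree ([:-1, 0, 1 :: real:] ^ l) = 2 * l" "[:-1, 0, 1 :: real:] ^ l \<noteq> 0"
    by (simp_all add: degree_power_eq)
  then have "(pderiv ^^ l) ([:-1, 0, 1 :: real:] ^ l) \<noteq> 0"
    using higher_pderiv_nonzero by simp
  then show ?thesis by (simp add: legendre_def)
qed

text \<open>The roots of countably many nonzero polynomials form a countable set, which cannot
  exhaust an interval. The height \<open>t\<close> found here provides a point off the axis at which
  no harmonic of order zero vanishes.\<close>

lemma ex_height_legendre_nonzero:
  "\<exists>t::real. 0 < t \<and> t < 1 \<and> (\<forall>l. poly (legendre l) t \<noteq> 0)"
proof -
  have "countable (\<Union>l. {t. poly (legendre l) t = 0})"
    using poly_roots_finite[OF legendre_nonzero] by (intro countable_UN) (auto intro: countable_finite)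
  moreover have "uncountable {0<..<1 :: real}"
    by (simp add: uncountable_open_interval)
  ultimately have "\<not> {0<..<1} \<subseteq> (\<Union>l. {t. poly (legendre l) t = 0})"
    using countable_subset by blast
  then show ?thesis by auto
qed

text \<open>Vanishing at one point is an event of the product sigma-algebra, since evaluation at
  that point is a coordinate; equality of the laws therefore transfers its probability.\<close>

lemma isotropic_prob_eq_0:
  fixes X :: "'w \<Rightarrow> real^3 \<Rightarrow> complex"
  assumes iso: "isotropic M X" and "rotation_matrix g"
    and meas: "\<And>x. x \<in> S2 \<Longrightarrow> (\<lambda>\<omega>. X \<omega> x) \<in> borel_measurable M"
    and x: "x \<in> S2"
  shows "measure M {\<omega> \<in> space M. X \<omega> (g *v x) = 0} = measure M {\<omega> \<in> space M. X \<omega> x = 0}"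
proof -
  let ?P = "PiM S2 (\<lambda>_. borel) :: (real^3 \<Rightarrow> complex) measure"
  define A where "A = {f \<in> space ?P. f x = 0}"
  have "(\<lambda>f. f x) \<in> measurable ?P borel"
    by (rule measurable_component_singleton[OF x])
  then have A: "A \<in> sets ?P" unfolding A_def by measurable
  have g: "g *v y \<in> S2" if "y \<in> S2" for y
  proof -
    have "orthogonal_transformation ((*v) g)"
      using \<open>rotation_matrix g\<close> by (simp add: rotation_matrix_def orthogonal_transformation_matrix)
    then show ?thesis
      using that by (simp add: orthogonal_transformation_norm)
  qed
  have *: "measure (distr M ?P (\<lambda>\<omega>. \<lambda>y\<in>S2. X \<omega> (h y))) A = measure M {\<omega> \<in> space M. X \<omega> (h x) = 0}"
    if h: "\<And>y. y \<in> S2 \<Longrightarrow> h y \<in> S2" for h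
  proof -
    have h_meas: "(\<lambda>\<omega>. \<lambda>y\<in>S2. X \<omega> (h y)) \<in> measurable M ?P"
      by (intro measurable_restrict meas h)
    have "(\<lambda>\<omega>. \<lambda>y\<in>S2. X \<omega> (h y)) -` A \<inter> space M = {\<omega> \<in> space M. X \<omega> (h x) = 0}"
      using x measurable_space[OF h_meas] by (auto simp: A_def)
    then show ?thesis
      by (simp only: measure_distr[OF h_meas A])
  qed
  have "distr M ?P (\<lambda>\<omega>. \<lambda>y\<in>S2. X \<omega> (g *v y)) = distr M ?P (\<lambda>\<omega>. \<lambda>y\<in>S2. X \<omega> y)"
    using iso \<open>rotation_matrix g\<close> by (simp add: isotropic_def)
  then show ?thesis
    using *[of "\<lambda>y. g *v y"] *[of "\<lambda>y. y"] g by simp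
qed

context thresholded_field
begin

text \<open>At the pole only the orders \<open>m = 0\<close> contribute, whereas at a point off the axis where no
  \<open>Y\<^sub>l\<^sub>0\<close> vanishes the orders \<open>\<plusminus>1\<close> contribute as well; so the field vanishes with strictly larger
  probability at the pole.\<close>

lemma not_isotropic_reg_field: "\<not> isotropic M X"
proof
  assume iso: "isotropic M X"
  obtain t :: real where t: "0 < t" "t < 1" "\<forall>l. poly (legendre l) t \<noteq> 0"
    using ex_height_legendre_nonzero by blast
  \<comment> \<open>The second coordinate of \<open>x\<close> is zero, so the harmonic of degree and
    order \<open>1\<close> is real there, and the first is positive, so it does not vanish.\<close>
  define e x :: "real^3" where "e = axis 3 1" and "x = vector [sqrt (1 - t\<^sup>2), 0, t]"
  have t2: "t\<^sup>2 < 1" using t by (simp add: power_less_one_iff)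
  have e: "e \<in> S2" "e $ 1 = 0" "e $ 2 = 0"
    by (simp add: e_def) (simp_all add: e_def axis_def)
  have x: "x \<in> S2" "x $ 1 > 0" "x $ 2 = 0" "x $ 3 = t"
    using t t2 by (simp_all add: x_def norm_vec_def L2_set_def sum_3)
  obtain f where f: "orthogonal_transformation f" "det (matrix f) = 1" "f e = x"
    using rotation_exists[of e x] e x by auto
  have rot: "rotation_matrix (matrix f)" "matrix f *v e = x"
    using f by (auto simp: rotation_matrix_def orthogonal_transformation_matrix matrix_works)
  have eq: "prob {\<omega> \<in> space M. X \<omega> x = 0} = prob {\<omega> \<in> space M. X \<omega> e = 0}"
    using isotropic_prob_eq_0[OF iso rot(1) borel_measurable_reg_field e(1)] rot(2) by simp
  have [measurable]: "(\<lambda>\<omega>. X \<omega> x) \<in> borel_measurable M" "(\<lambda>\<omega>. X \<omega> e) \<in> borel_measurable M"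
    using borel_measurable_reg_field e x by auto
  \<comment> \<open>\<open>S\<close> separates the two points: up to null sets, the field vanishes
    at \<open>e\<close> throughout \<open>S\<close>, whereas vanishing at \<open>x\<close> forces
    \<open>S\<close> and excludes its subset \<open>one_large 1 1\<close>.\<close>
  define S where "S = {\<omega> \<in> space M. \<forall>l. cmod (coeff (l, 0) \<omega>) \<le> lam}"
  have [measurable]: "S \<in> events" unfolding S_def by measurable
  have "prob S \<le> prob {\<omega> \<in> space M. X \<omega> e = 0}"
  proof (rule finite_measure_mono_AE)
    show "AE \<omega> in M. \<omega> \<in> S \<longrightarrow> \<omega> \<in> {\<omega> \<in> space M. X \<omega> e = 0}"
      using AE_square_integrable
    proof eventually_elim
      case (elim \<omega>)
      show ?case
      proof
        assume S: "\<omega> \<in> S"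
        have "paired_term (\<lambda>l m. sph_harm l m e) l k (soft_threshold lam (coeff (l, k) \<omega>)) = 0" for l k
        proof (cases "k = 0")
          case True
          have "cmod (coeff (l, 0) \<omega>) \<le> lam" using S unfolding S_def by blast
          then show ?thesis using True by (simp add: soft_threshold_def)
        next
          case False
          \<comment> \<open>A harmonic of nonzero order contains a positive power of
            \<open>Complex (x $ 1) (x $ 2)\<close> or its conjugate, which is zero on the
            axis.\<close>
          then have "sph_harm l (int k) e = 0" "sph_harm l (- int k) e = 0"
            using e by (simp_all add: sph_harm_minus, simp_all add: sph_harm_def sph_harm_nonneg_def flip: zero_complex.code)
          then show ?thesis by (simp add: paired_term_def)
        qed
        then have "(\<lambda>l. 0) sums X \<omega> e" using reg_field_sums[OF elim, of e] by simp
        then show "\<omega> \<in> {\<omega> \<in> space M. X \<omega> e = 0}"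
          using S sums_unique2[OF sums_zero] by (auto simp: S_def)
      qed
    qed
  qed measurable
  moreover have "prob {\<omega> \<in> space M. X \<omega> x = 0} \<le> prob (S - one_large 1 1)"
  proof (rule finite_measure_mono_AE)
    have Y0: "sph_harm l 0 x \<noteq> 0" for l
      using t(3) x by (simp add: sph_harm_def sph_harm_nonneg_def)
    have "legendre 1 = [:0, 1:]"
      by (simp add: legendre_def pderiv_pCons)
    then obtain y where Y1: "sph_harm 1 1 x = of_real y" "y \<noteq> 0"
      using x that[of "- sqrt (3 / (4 * pi) / 2) * x $ 1"]
      by (auto simp: sph_harm_def sph_harm_nonneg_def pderiv_pCons complex_eq_iff)
    \<comment> \<open>The sign from the symmetry of the coefficients and the sign in
      \<open>sph_harm_minus\<close> cancel, so the two orders add up to \<open>y\<close> times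
      \<open>z + cnj z\<close>.\<close>
    have pair: "paired_term (\<lambda>l m. sph_harm l m x) 1 1 z = of_real (2 * y * Re z)" for z
      using sph_harm_minus[of 1 1 x] Y1
      by (simp add: paired_term_def complex_eq_iff)
    have "AE \<omega> in M. \<forall>l. lam < cmod (coeff (l, 0) \<omega>) \<longrightarrow> X \<omega> x \<noteq> 0"
      unfolding AE_all_countable using AE_reg_field_nonzero[OF Y0] by simp
    moreover have "AE \<omega> in M. \<omega> \<in> one_large 1 1 \<longrightarrow> X \<omega> x \<noteq> 0"
      using AE_one_large[of 1 1 x, OF order_refl]
      by eventually_elim (use Y1 in \<open>auto simp: pair simp del: One_nat_def\<close>)
    ultimately show "AE \<omega> in M. \<omega> \<in> {\<omega> \<in> space M. X \<omega> x = 0} \<longrightarrow> \<omega> \<in> S - one_large 1 1"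
      by eventually_elim (auto simp: S_def not_less)
  qed measurable
  moreover have "prob (S - one_large 1 1) = prob S - prob (one_large 1 1)"
  proof (rule finite_measure_Diff)
    show "one_large 1 1 \<subseteq> S"
    proof
      fix \<omega> assume \<omega>: "\<omega> \<in> one_large 1 1"
      have "cmod (coeff (l, 0) \<omega>) \<le> lam" for l
      proof -
        have "\<forall>l k. k \<le> l \<longrightarrow> (l, k) \<noteq> (1, 1) \<longrightarrow> cmod (coeff (l, k) \<omega>) \<le> lam"
          using \<omega> unfolding one_large_def mem_Collect_eq by (elim conjE)
        from this[rule_format, of 0 l] show ?thesis by simp
      qed
      then show "\<omega> \<in> S" using \<omega> by (simp add: S_def one_large_def)
    qed
  qed measurable
  moreover have "prob (one_large 1 1) > 0"
    by (rule prob_one_large_pos) simp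
  ultimately show False using eq by linarith
qed

end

text \<open>The weight costs one power of \<open>l\<close>, leaving the exponent
  \<open>1 - \<alpha>\<close>, which is below \<open>-1\<close> because \<open>\<alpha> > 2\<close>.
  The factor \<open>2\<close> comes from \<open>Suc l <= 2 * l\<close> for
  \<open>l >= 1\<close>.\<close>

lemma summable_linear_times_powr_bound:
  fixes C :: "nat \<Rightarrow> real"
  assumes "\<And>l. 0 < C l" "\<alpha> > 2" and C: "\<And>l. l \<ge> 1 \<Longrightarrow> C l \<le> K * real l powr (- \<alpha>)"
  shows "summable (\<lambda>l. real (Suc l) * C l)"
proof (rule summable_comparison_test')
  show "summable (\<lambda>l. 2 * K * real l powr (1 - \<alpha>))"
    using assms(2) by (intro summable_mult) (simp add: summable_real_powr_iff)
  fix l :: nat assume l: "l \<ge> 1"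
  have "real (Suc l) * C l \<le> (2 * real l) * (K * real l powr (- \<alpha>))"
    using l assms(1)[of l] C[OF l] by (intro mult_mono) auto
  also have "\<dots> = 2 * K * real l powr (1 - \<alpha>)"
    using l by (simp add: powr_diff powr_minus field_simps)
  finally show "norm (real (Suc l) * C l) \<le> 2 * K * real l powr (1 - \<alpha>)"
    using assms(1)[of l] by simp
qed

theorem theorem3:
  fixes M :: "'w measure"
    and T :: "'w \<Rightarrow> real^3 \<Rightarrow> real"
    and C :: "nat \<Rightarrow> real"
    and K \<alpha> \<delta> \<epsilon> lam :: real
  assumes "prob_space M"
    and "random_field M T"
    and "zero_mean M T"
    and "gaussian_field M T"
    and "isotropic M T"
    and "angular_power_spectrum M T C"
    and "\<And>l. 0 < C l"
    and "K > 0" and "\<alpha> > 2"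
    and "\<And>l. l \<ge> 1 \<Longrightarrow> C l \<le> K * real l powr (- \<alpha>)"
    and "\<delta> > 0" and "\<epsilon> > 0" and "lam > 0"
    and "measure M {\<omega> \<in> space M.
           L2_norm_S2 (\<lambda>x. complex_of_real (T \<omega> x) -
             L2_sum (reg_coeff lam (\<lambda>y. complex_of_real (T \<omega> y))) x) \<le> ennreal \<epsilon>}
         \<ge> 1 - \<delta>"
  shows "random_field M (reg_field lam T) \<and>
         \<not> isotropic M (reg_field lam T) \<and>
         \<not> gaussian_field M (reg_field lam T)"
proof -
  interpret prob_space M by fact
  have "summable (\<lambda>l. real (Suc l) * C l)"
    using assms(7,9,10) by (rule summable_linear_times_powr_bound)
  then interpret thresholded_field M T C lam
    using assms by unfold_locales
  show ?thesis
    using random_field_reg_field not_isotropic_reg_field not_gaussian_reg_field by blast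
qed

end
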